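(* Let $H$ be a complex separable infinite-dimensional Hilbert space. For all $k,n,m\in\{0,1,2,\ldots,\infty\}$ with $k$ finite, the following hold, where all topological notions refer to the norm topology of $B(H)$: (a) $\Sigma_k(H)$ is of type $F\cap G$; (b) $\Sigma^1_{n,m}(H)$ is of type $F\cap G$ provided $m$ or $n$ is finite, and it is open provided $m=0$ or $n=0$; (c) $\Sigma^0_{0,0}(H)$ is $G_\delta$; $\Sigma^0_{n,m}(H)$ is of type $F_\sigma\cap G_\delta$ if $n$ and $m$ are both finite; $\Sigma^0_{n,m}(H)$ is $F_{\sigma\delta}$ if one of $n,m$ is infinite and the other is finite; (d) $\Sigma^1_{\infty,\infty}(H)$ and $\Sigma^0_{\infty,\infty}(H)$ are Borel.
   Context: $B(H)$ is the algebra of all bounded linear operators on $H$. For $A\in B(H)$, $N(A)$ and $R(A)$ denote the kernel and the range of $A$, $\overline{R}(A)$ the closure of the range, and $R(A)^\perp$ the orthogonal complement of the range. Since $H$ is separable, dimensions are elements of $\{0,1,2,\ldots,\infty\}$. For finite $k\geq 0$, $\Sigma_k(H)=\{A\in B(H):\dim R(A)=k\}$. For $n,m\in\{0,1,2,\ldots,\infty\}$, $\Sigma^1_{n,m}(H)$ (respectively $\Sigma^0_{n,m}(H)$) is the set of all $A\in B(H)$ such that $\dim N(A)=n$, $\dim R(A)^\perp=m$, $\dim\overline{R}(A)=\infty$, and $R(A)$ is closed (respectively $R(A)$ is not closed). A set is of type $F\cap G$ if it is the intersection of a closed set and an open set, and of type $F_\sigma\cap G_\delta$ if it is the intersection of an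 $F_\sigma$ set and a $G_\delta$ set. Borel means belonging to the $\sigma$-algebra generated by the norm-open sets. *)

theory Defs
  imports "HOL-Analysis.Analysis" "HOL-Library.Extended_Nat"
begin

section \<open>Complex Hilbert spaces\<close>

text \<open>
  The real inner product, norm, metric and topology of the underlying \<^class>\<open>real_inner\<close> space are
  the usual ones induced by \<open>cinner\<close>: the class ties \<open>inner x y\<close> to the real part of
  \<open>cinner x y\<close>, and \<^class>\<open>real_inner\<close> contributes positive definiteness and
  \<open>norm x = sqrt (inner x x)\<close>. The convention is linearity of \<open>cinner\<close> in the first argument.
\<close>

class complex_inner = real_inner +
  fixes scaleC :: "complex \<Rightarrow> 'a \<Rightarrow> 'a"  (infixr \<open>*\<^sub>C\<close> 75)
    and cinner :: "'a \<Rightarrow> 'a \<Rightarrow> complex"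
  assumes scaleC_add_right: "c *\<^sub>C (x + y) = c *\<^sub>C x + c *\<^sub>C y"
    and scaleC_add_left: "(c + d) *\<^sub>C x = c *\<^sub>C x + d *\<^sub>C x"
    and scaleC_scaleC: "c *\<^sub>C d *\<^sub>C x = (c * d) *\<^sub>C x"
    and scaleC_one: "1 *\<^sub>C x = x"
    and scaleR_scaleC: "scaleR r x = complex_of_real r *\<^sub>C x"
    and cinner_commute: "cinner x y = cnj (cinner y x)"
    and cinner_add_left: "cinner (x + y) z = cinner x z + cinner y z"
    and cinner_scaleC_left: "cinner (c *\<^sub>C x) y = c * cinner x y"
    and inner_eq_Re_cinner: "inner x y = Re (cinner x y)"

class complex_hilbert = complex_inner + complete_space

global_interpretation complex_vector: vector_space "scaleC :: complex \<Rightarrow> 'a \<Rightarrow> 'a::complex_inner"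
  by unfold_locales
    (simp_all add: scaleC_add_right scaleC_add_left scaleC_scaleC scaleC_one)

instantiation complex :: complex_hilbert
begin

definition scaleC_complex :: "complex \<Rightarrow> complex \<Rightarrow> complex"
  where "scaleC_complex c x = c * x"

definition cinner_complex :: "complex \<Rightarrow> complex \<Rightarrow> complex"
  where "cinner_complex x y = x * cnj y"

instance
  by standard
    (simp_all add: scaleC_complex_def cinner_complex_def inner_complex_def algebra_simps
      scaleR_conv_of_real)

end

text \<open>
  Complex dimension with values in \<open>{0, 1, 2, \<dots>, \<infinity>}\<close>. The library function \<open>dim\<close> is only
  meaningful on finite-dimensional sets, hence the case distinction. For a closed subspace of a
  separable Hilbert space this is the Hilbert space dimension, with \<open>\<infinity>\<close> for the countably infinite
  cardinal.
\<close>

definition cdim :: "'a::complex_inner set \<Rightarrow> enat"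
  where "cdim V =
    (if \<exists>B. finite B \<and> V \<subseteq> complex_vector.span B then enat (complex_vector.dim V) else \<infinity>)"

definition orth_compl :: "'a::complex_inner set \<Rightarrow> 'a set"
  where "orth_compl S = {y. \<forall>x\<in>S. cinner x y = 0}"


section \<open>The algebra of bounded operators\<close>

text \<open>
  \<^typ>\<open>'a \<Rightarrow>\<^sub>L 'a\<close> consists of the bounded real-linear maps with the operator norm; \<open>B(H)\<close> is its
  subspace of complex-linear maps.
\<close>

definition bounded_ops :: "('a::complex_hilbert \<Rightarrow>\<^sub>L 'a) set"
  where "bounded_ops =
    {A. \<forall>c x. blinfun_apply A (c *\<^sub>C x) = c *\<^sub>C blinfun_apply A x}"

definition norm_topology :: "('a::complex_hilbert \<Rightarrow>\<^sub>L 'a) topology"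
  where "norm_topology = top_of_set bounded_ops"

definition null_space :: "('a::complex_hilbert \<Rightarrow>\<^sub>L 'a) \<Rightarrow> 'a set"
  where "null_space A = {x. blinfun_apply A x = 0}"

abbreviation op_range :: "('a::complex_hilbert \<Rightarrow>\<^sub>L 'a) \<Rightarrow> 'a set"
  where "op_range A \<equiv> range (blinfun_apply A)"

definition Sigma_rank :: "nat \<Rightarrow> ('a::complex_hilbert \<Rightarrow>\<^sub>L 'a) set"
  where "Sigma_rank k = {A \<in> bounded_ops. cdim (op_range A) = enat k}"

definition Sigma1 :: "enat \<Rightarrow> enat \<Rightarrow> ('a::complex_hilbert \<Rightarrow>\<^sub>L 'a) set"
  where "Sigma1 n m =
    {A \<in> bounded_ops. cdim (null_space A) = n \<and> cdim (orth_compl (op_range A)) = m \<and>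
       cdim (closure (op_range A)) = \<infinity> \<and> closed (op_range A)}"

definition Sigma0 :: "enat \<Rightarrow> enat \<Rightarrow> ('a::complex_hilbert \<Rightarrow>\<^sub>L 'a) set"
  where "Sigma0 n m =
    {A \<in> bounded_ops. cdim (null_space A) = n \<and> cdim (orth_compl (op_range A)) = m \<and>
       cdim (closure (op_range A)) = \<infinity> \<and> \<not> closed (op_range A)}"


section \<open>Descriptive classes of subsets of a topological space\<close>

definition F_Int_G_in :: "'a topology \<Rightarrow> 'a set \<Rightarrow> bool"
  where "F_Int_G_in X S \<longleftrightarrow> (\<exists>F G. closedin X F \<and> openin X G \<and> S = F \<inter> G)"

definition fsigma_Int_gdelta_in :: "'a topology \<Rightarrow> 'a set \<Rightarrow> bool"
  where "fsigma_Int_gdelta_in X S \<longleftrightarrow> (\<exists>F G. fsigma_in X F \<and> gdelta_in X G \<and> S = F \<inter> G)"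

definition fsigma_delta_in :: "'a topology \<Rightarrow> 'a set \<Rightarrow> bool"
  where "fsigma_delta_in X S \<longleftrightarrow>
    (\<exists>F :: nat \<Rightarrow> 'a set. (\<forall>i. fsigma_in X (F i)) \<and> S = (\<Inter>i. F i))"

definition borel_in :: "'a topology \<Rightarrow> 'a set \<Rightarrow> bool"
  where "borel_in X S \<longleftrightarrow> S \<in> sigma_sets (topspace X) {U. openin X U}"

end

theory Submission
  imports Defs
begin

text \<open>
  Two facts carry the theorem. First, \<open>R(A)\<close> is closed iff for some \<open>c > 0\<close> the inequality
  \<open>c \<bar>\<langle>A x, y\<rangle>\<bar> \<le> \<parallel>A x\<parallel> \<parallel>A\<^sup>* y\<parallel>\<close> holds for all \<open>x\<close>, \<open>y\<close>. For fixed \<open>c\<close> this is a norm-closed condition on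
  \<open>A\<close>, symmetric in \<open>A\<close> and \<open>A\<^sup>*\<close>, so the operators with closed range form an \<open>F\<^sub>\<sigma>\<close> set. Second, a
  subspace with \<open>\<parallel>v - A x\<parallel> \<ge> \<parallel>v\<parallel> / n\<close> for all its elements \<open>v\<close> and all \<open>x\<close> has dimension at most
  \<open>dim R(A)\<^sup>\<bottom>\<close>, and by separability \<open>dim R(A)\<^sup>\<bottom> \<ge> k\<close> is always witnessed by a subspace spanned by \<open>k\<close>
  members of a fixed countable dense set; hence \<open>dim R(A)\<^sup>\<bottom> \<ge> k\<close>, and dually \<open>dim N(A) \<ge> k\<close>, is an
  \<open>F\<^sub>\<sigma>\<close> condition. The sharper statements for finite \<open>n\<close> or \<open>m\<close> follow from the stability of the
  index and the upper semicontinuity of the nullity on semi-Fredholm operators.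
\<close>

section \<open>The complex inner product\<close>

abbreviation clinear :: "('a::complex_inner \<Rightarrow> 'b::complex_inner) \<Rightarrow> bool"
  where "clinear \<equiv> module_hom scaleC scaleC"

abbreviation csubspace :: "'a::complex_inner set \<Rightarrow> bool"
  where "csubspace \<equiv> complex_vector.subspace"

abbreviation cspan :: "'a::complex_inner set \<Rightarrow> 'a set"
  where "cspan \<equiv> complex_vector.span"

lemma clinearI:
  assumes "\<And>x y. f (x + y) = f x + f y" and "\<And>c x. f (c *\<^sub>C x) = c *\<^sub>C f x"
  shows "clinear f"
  by unfold_locales (auto simp: assms)

lemma cinner_add_right: "cinner x (y + z) = cinner x y + cinner x z"
  by (metis cinner_add_left cinner_commute complex_cnj_add)

lemma cinner_scaleC_right: "cinner x (c *\<^sub>C y) = cnj c * cinner x y"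
  by (metis cinner_scaleC_left cinner_commute complex_cnj_mult)

lemma Im_cinner_self: "Im (cinner x x) = 0"
  by (metis cinner_commute complex_cnj_cancel_iff complex_is_Real_iff Reals_cnj_iff)

lemma cinner_self: "cinner x x = complex_of_real ((norm x)\<^sup>2)"
  by (simp add: complex_eq_iff Im_cinner_self flip: inner_eq_Re_cinner power2_norm_eq_inner)

lemma norm_scaleC: "norm (c *\<^sub>C x) = cmod c * norm x"
proof -
  have "complex_of_real ((norm (c *\<^sub>C x))\<^sup>2) = c * cnj c * cinner x x"
    unfolding cinner_self[symmetric] by (simp add: cinner_scaleC_left cinner_scaleC_right)
  also have "\<dots> = complex_of_real ((cmod c * norm x)\<^sup>2)"
    by (simp add: cinner_self power_mult_distrib flip: complex_norm_square)
  finally have "complex_of_real ((norm (c *\<^sub>C x))\<^sup>2) = complex_of_real ((cmod c * norm x)\<^sup>2)" .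
  then have "(norm (c *\<^sub>C x))\<^sup>2 = (cmod c * norm x)\<^sup>2"
    using of_real_eq_iff by blast
  then show ?thesis
    by (metis mult_nonneg_nonneg norm_ge_zero power2_eq_iff_nonneg)
qed

lemma cmod_cinner_le: "cmod (cinner x y) \<le> norm x * norm y"
proof -
  \<comment> \<open>Multiplying by the conjugate phase \<open>c\<close> makes the inner product real
    and nonnegative, so the real Cauchy-Schwarz inequality applies. For a vanishing inner product
    the division yields \<open>c = 0\<close>.\<close>
  define c where "c = cnj (cinner x y) / complex_of_real (cmod (cinner x y))"
  have c: "cmod c \<le> 1"
    by (simp add: c_def norm_divide)
  have "c * cinner x y = complex_of_real (cmod (cinner x y))"
    using complex_norm_square[of "cinner x y"]
    by (cases "cinner x y = 0") (simp_all add: c_def power2_eq_square mult.commute divide_eq_eq)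
  then have "cmod (cinner x y) = inner (c *\<^sub>C x) y"
    by (simp add: inner_eq_Re_cinner cinner_scaleC_left)
  also have "\<dots> \<le> norm (c *\<^sub>C x) * norm y"
    by (rule norm_cauchy_schwarz)
  also have "\<dots> \<le> norm x * norm y"
    using c by (simp add: norm_scaleC mult_left_le_one_le mult_right_mono)
  finally show ?thesis .
qed

lemma bounded_bilinear_cinner: "bounded_bilinear cinner"
proof
  show "\<exists>K. \<forall>a b. norm (cinner a b) \<le> norm a * norm b * K"
    by (rule exI[of _ 1]) (simp add: cmod_cinner_le)
qed (simp_all add: cinner_add_left cinner_add_right scaleR_scaleC cinner_scaleC_left
    cinner_scaleC_right scaleC_complex_def)

lemma bounded_bilinear_scaleC: "bounded_bilinear scaleC"
proof
  show "\<exists>K. \<forall>a b. norm (scaleC a b) \<le> norm a * norm b * K"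
    by (rule exI[of _ 1]) (simp add: norm_scaleC)
qed (simp_all add: scaleC_add_left scaleC_add_right scaleR_scaleC scaleC_scaleC
    scaleC_complex_def mult.commute)

lemmas continuous_on_cinner [continuous_intros] =
  bounded_bilinear.continuous_on[OF bounded_bilinear_cinner]
lemmas continuous_on_scaleC [continuous_intros] =
  bounded_bilinear.continuous_on[OF bounded_bilinear_scaleC]
lemmas tendsto_scaleC = bounded_bilinear.tendsto[OF bounded_bilinear_scaleC]
lemmas cinner_simps =
  cinner_add_left cinner_add_right cinner_scaleC_left cinner_scaleC_right
  bounded_bilinear.diff_left[OF bounded_bilinear_cinner]
  bounded_bilinear.diff_right[OF bounded_bilinear_cinner]
  bounded_bilinear.zero_left[OF bounded_bilinear_cinner]
  bounded_bilinear.zero_right[OF bounded_bilinear_cinner]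
  bounded_bilinear.minus_left[OF bounded_bilinear_cinner]
  bounded_bilinear.minus_right[OF bounded_bilinear_cinner]

lemma cinner_self_eq_0: "cinner x x = 0 \<longleftrightarrow> x = 0"
  by (simp add: cinner_self)

lemma cinner_eq_0_commute: "cinner x y = 0 \<longleftrightarrow> cinner y x = 0"
  by (metis cinner_commute complex_cnj_zero_iff)

lemma cinner_ext:
  assumes "\<And>x. cinner x y = cinner x z" shows "y = z"
proof -
  have "cinner (y - z) (y - z) = 0"
    using assms[of "y - z"] by (simp add: cinner_simps)
  then show ?thesis by (simp add: cinner_self_eq_0)
qed

lemma norm_add_sq_orthogonal:
  assumes "cinner x y = 0"
  shows "(norm (x + y))\<^sup>2 = (norm x)\<^sup>2 + (norm y)\<^sup>2"
  using assms by (simp add: power2_norm_eq_inner inner_simps inner_eq_Re_cinner[of x y]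
      inner_commute[of y x])

lemma csubspace_closure:
  assumes "csubspace S" shows "csubspace (closure S)"
proof (rule complex_vector.subspaceI)
  show "0 \<in> closure S"
    using assms complex_vector.subspace_0 closure_subset by blast
next
  fix x y assume "x \<in> closure S" "y \<in> closure S"
  then obtain f g where f: "\<And>n. f n \<in> S" "f \<longlonglongrightarrow> x" and g: "\<And>n. g n \<in> S" "g \<longlonglongrightarrow> y"
    by (auto simp: closure_sequential)
  have "(\<lambda>n. f n + g n) \<longlonglongrightarrow> x + y"
    by (intro tendsto_add f g)
  then show "x + y \<in> closure S"
    unfolding closure_sequential
    using f(1) g(1) complex_vector.subspace_add[OF assms] by (intro exI[of _ "\<lambda>n. f n + g n"]) auto
next
  fix c x assume "x \<in> closure S"
  then obtain f where f: "\<And>n. f n \<in> S" "f \<longlonglongrightarrow> x"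
    by (auto simp: closure_sequential)
  have "(\<lambda>n. c *\<^sub>C f n) \<longlonglongrightarrow> c *\<^sub>C x"
    by (intro tendsto_scaleC tendsto_const f)
  then show "c *\<^sub>C x \<in> closure S"
    unfolding closure_sequential
    using f(1) complex_vector.subspace_scale[OF assms] by (intro exI[of _ "\<lambda>n. c *\<^sub>C f n"]) auto
qed

lemma csubspace_orth_compl: "csubspace (orth_compl S)"
  by (rule complex_vector.subspaceI) (auto simp: orth_compl_def cinner_simps)

lemma closed_orth_compl: "closed (orth_compl S)"
proof -
  have "orth_compl S = (\<Inter>x\<in>S. {y. cinner x y = 0})"
    by (auto simp: orth_compl_def)
  moreover have "closed {y. cinner x y = 0}" for x :: 'a
    by (intro closed_Collect_eq continuous_intros)
  ultimately show ?thesis by auto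
qed

lemma orth_complD: "y \<in> orth_compl S \<Longrightarrow> x \<in> S \<Longrightarrow> cinner x y = 0"
  by (simp add: orth_compl_def)

lemma orth_compl_Int: "x \<in> S \<Longrightarrow> x \<in> orth_compl S \<Longrightarrow> x = 0"
  using orth_complD cinner_self_eq_0 by blast

lemma orth_compl_closure: "orth_compl (closure S) = orth_compl S"
proof
  show "orth_compl (closure S) \<subseteq> orth_compl S"
    using closure_subset[of S] by (auto simp: orth_compl_def)
  show "orth_compl S \<subseteq> orth_compl (closure S)"
  proof
    fix y assume y: "y \<in> orth_compl S"
    have "closure S \<subseteq> {x. cinner x y = 0}"
      using y by (intro closure_minimal closed_Collect_eq continuous_intros) (auto simp: orth_compl_def)
    then show "y \<in> orth_compl (closure S)"
      by (auto simp: orth_compl_def)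
  qed
qed

section \<open>Orthogonal projections\<close>

text \<open>A sequence in \<open>S\<close> minimizing the distance to \<open>x\<close> is Cauchy by
  the parallelogram law. Its limit is a nearest point, and a nearest point leaves a residual
  orthogonal to \<open>S\<close>.\<close>

lemma projection_exists:
  fixes S :: "'a::complex_hilbert set"
  assumes S: "closed S" "csubspace S"
  shows "\<exists>p\<in>S. x - p \<in> orth_compl S"
proof -
  define d where "d = (INF p\<in>S. (norm (x - p))\<^sup>2)"
  have S0: "0 \<in> S" using S(2) complex_vector.subspace_0 by blast
  have bdd: "bdd_below ((\<lambda>p. (norm (x - p))\<^sup>2) ` S)"
    by (rule bdd_belowI[of _ 0]) auto
  have dle: "d \<le> (norm (x - p))\<^sup>2" if "p \<in> S" for p
    unfolding d_def by (rule cINF_lower[OF bdd that])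
  have "\<exists>p\<in>S. (norm (x - p))\<^sup>2 < d + 1 / real (Suc n)" for n
  proof -
    have "d < d + 1 / real (Suc n)" by simp
    then show ?thesis
      using cINF_less_iff[of S "\<lambda>p. (norm (x - p))\<^sup>2"] S0 bdd unfolding d_def by blast
  qed
  then obtain p where pS: "\<And>n. p n \<in> S" and p: "\<And>n. (norm (x - p n))\<^sup>2 < d + 1 / real (Suc n)"
    by metis
  have close: "(norm (p n - p m))\<^sup>2 < 2 / real (Suc n) + 2 / real (Suc m)" for n m
  proof -
    have "(1/2) *\<^sub>C (p n + p m) \<in> S"
      using pS S(2) by (intro complex_vector.subspace_scale complex_vector.subspace_add)
    then have "d \<le> (norm (x - (1/2) *\<^sub>R (p n + p m)))\<^sup>2"
      using dle by (simp add: scaleR_scaleC)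
    \<comment> \<open>This is the parallelogram law for \<open>x - p n\<close> and
      \<open>x - p m\<close>; the midpoint lies in \<open>S\<close>, so its distance term is at
      least \<open>d\<close>.\<close>
    moreover have "(norm (p n - p m))\<^sup>2 + 4 * (norm (x - (1/2) *\<^sub>R (p n + p m)))\<^sup>2
        = 2 * (norm (x - p n))\<^sup>2 + 2 * (norm (x - p m))\<^sup>2"
      unfolding power2_norm_eq_inner
      by (simp add: inner_simps inner_commute algebra_simps)
    ultimately show ?thesis
      using p[of n] p[of m] by (simp add: algebra_simps)
  qed
  have "Cauchy p"
  proof (rule CauchyI')
    fix e :: real assume "0 < e"
    then obtain N where N: "4 / e\<^sup>2 < real N"
      using reals_Archimedean2 by blast
    have "dist (p m) (p n) < e" if "N \<le> m" "N \<le> n" for m n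
    proof -
      have *: "4 / e\<^sup>2 < real (Suc m)" "4 / e\<^sup>2 < real (Suc n)" using N that by linarith+
      then have "2 / real (Suc m) \<le> e\<^sup>2 / 2" "2 / real (Suc n) \<le> e\<^sup>2 / 2"
        using \<open>0 < e\<close> by (simp_all add: field_simps)
      then have "(norm (p m - p n))\<^sup>2 < e\<^sup>2"
        using close[of m n] by linarith
      then show ?thesis
        using \<open>0 < e\<close> by (simp add: dist_norm power2_less_imp_less)
    qed
    then show "\<exists>M. \<forall>m\<ge>M. \<forall>n>m. dist (p m) (p n) < e"
      by (intro exI[of _ N]) auto
  qed
  then obtain q where q: "p \<longlonglongrightarrow> q"
    using Cauchy_convergent_iff convergent_def by blast
  have qS: "q \<in> S"
    using closed_sequentially[OF S(1)] pS q by blast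
  have "(norm (x - q))\<^sup>2 \<le> d"
  proof (rule LIMSEQ_le)
    show "(\<lambda>n. (norm (x - p n))\<^sup>2) \<longlonglongrightarrow> (norm (x - q))\<^sup>2"
      by (intro tendsto_intros q)
    show "(\<lambda>n. d + 1 / real (Suc n)) \<longlonglongrightarrow> d"
      using LIMSEQ_inverse_real_of_nat_add[of d] by (simp add: inverse_eq_divide)
    show "\<exists>N. \<forall>n\<ge>N. (norm (x - p n))\<^sup>2 \<le> d + 1 / real (Suc n)"
      using p less_imp_le by blast
  qed
  then have qmin: "(norm (x - q))\<^sup>2 \<le> (norm (x - s))\<^sup>2" if "s \<in> S" for s
    using dle[OF that] by linarith
  have "cinner y (x - q) = 0" if y: "y \<in> S" for y
  proof (cases "y = 0")
    case False
    \<comment> \<open>\<open>c *\<^sub>C y\<close> is the component of \<open>x - q\<close> along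
      \<open>y\<close>. By Pythagoras, adding it to \<open>q\<close> would give a nearer point of
      \<open>S\<close> unless it vanishes.\<close>
    define c where "c = cinner (x - q) y / complex_of_real ((norm y)\<^sup>2)"
    have orth: "cinner (x - q - c *\<^sub>C y) (c *\<^sub>C y) = 0"
      using False by (simp add: c_def cinner_simps cinner_self)
    have "(norm (x - q))\<^sup>2 = (norm (x - q - c *\<^sub>C y))\<^sup>2 + (norm (c *\<^sub>C y))\<^sup>2"
      using norm_add_sq_orthogonal[OF orth] by simp
    moreover have "(norm (x - q))\<^sup>2 \<le> (norm (x - q - c *\<^sub>C y))\<^sup>2"
      using qmin[of "q + c *\<^sub>C y"] y qS S(2)
      by (simp add: complex_vector.subspace_add complex_vector.subspace_scale diff_diff_eq)
    ultimately have "c *\<^sub>C y = 0" by simp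
    then have "c = 0" using False by simp
    then show ?thesis using False by (simp add: c_def cinner_eq_0_commute)
  qed (simp add: cinner_simps)
  then show ?thesis
    using qS by (auto simp: orth_compl_def)
qed

definition proj :: "'a::complex_hilbert set \<Rightarrow> 'a \<Rightarrow> 'a"
  where "proj S x = (SOME p. p \<in> S \<and> x - p \<in> orth_compl S)"

context
  fixes S :: "'a::complex_hilbert set"
  assumes S: "closed S" "csubspace S"
begin

lemma proj_in: "proj S x \<in> S" and proj_orth: "x - proj S x \<in> orth_compl S"
  using someI_ex[of "\<lambda>p. p \<in> S \<and> x - p \<in> orth_compl S"] projection_exists[OF S, of x]
  by (auto simp: proj_def)

lemma proj_unique:
  assumes "p \<in> S" "x - p \<in> orth_compl S" shows "proj S x = p"
proof -
  have "proj S x - p \<in> S"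
    by (intro complex_vector.subspace_diff S proj_in assms)
  moreover have "(x - p) - (x - proj S x) \<in> orth_compl S"
    by (intro complex_vector.subspace_diff csubspace_orth_compl proj_orth assms)
  ultimately show ?thesis
    using orth_compl_Int[of "proj S x - p" S] by simp
qed

lemma clinear_proj: "clinear (proj S)"
proof (rule clinearI; rule proj_unique)
  fix x y
  show "proj S x + proj S y \<in> S"
    by (intro complex_vector.subspace_add S proj_in)
  show "x + y - (proj S x + proj S y) \<in> orth_compl S"
    using complex_vector.subspace_add[OF csubspace_orth_compl proj_orth[of x] proj_orth[of y]]
    by (simp add: algebra_simps)
next
  fix c x
  show "c *\<^sub>C proj S x \<in> S"
    by (intro complex_vector.subspace_scale S proj_in)
  show "c *\<^sub>C x - c *\<^sub>C proj S x \<in> orth_compl S"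
    using complex_vector.subspace_scale[OF csubspace_orth_compl proj_orth[of x], of c]
    by (simp add: complex_vector.scale_right_diff_distrib)
qed

lemma proj_eq_self_iff: "proj S x = x \<longleftrightarrow> x \<in> S"
  using proj_in[of x] proj_unique[of x x] complex_vector.subspace_0[OF csubspace_orth_compl] by auto

lemma proj_eq_0_iff: "proj S x = 0 \<longleftrightarrow> x \<in> orth_compl S"
  using proj_orth[of x] proj_unique[of 0 x] complex_vector.subspace_0[OF S(2)] by auto

lemma norm_proj_le: "norm (proj S x) \<le> norm x"
proof -
  have "(norm (proj S x))\<^sup>2 \<le> (norm x)\<^sup>2"
    using norm_add_sq_orthogonal[OF orth_complD[OF proj_orth[of x] proj_in[of x]]] by simp
  then show ?thesis by simp
qed

lemma orth_compl_orth_compl: "orth_compl (orth_compl S) = S"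
proof
  show "S \<subseteq> orth_compl (orth_compl S)"
    by (auto simp: orth_compl_def cinner_eq_0_commute)
  show "orth_compl (orth_compl S) \<subseteq> S"
  proof
    fix x assume x: "x \<in> orth_compl (orth_compl S)"
    have "x - proj S x \<in> orth_compl (orth_compl S)"
      using proj_in \<open>S \<subseteq> _\<close> x by (intro complex_vector.subspace_diff csubspace_orth_compl) auto
    then have "x - proj S x = 0"
      using orth_compl_Int proj_orth by blast
    then show "x \<in> S" using proj_in[of x] by simp
  qed
qed

end

section \<open>Dimension\<close>

lemma cdim_cspan_independent:
  assumes "complex_vector.independent B"
  shows "cdim (cspan B) = (if finite B then enat (card B) else \<infinity>)"
proof (cases "finite B")
  case True
  then show ?thesis
    using complex_vector.dim_span_eq_card_independent[OF assms] by (auto simp: cdim_def)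
next
  case False
  have "\<not> (finite C \<and> cspan B \<subseteq> cspan C)" for C
    using complex_vector.independent_span_bound[of C B] assms False complex_vector.span_superset[of B]
    by blast
  then show ?thesis using False by (auto simp: cdim_def)
qed

text \<open>An upper bound may be witnessed by a spanning set outside \<open>V\<close>; a basis of
  \<open>V\<close> is independent in its span and hence no larger.\<close>

lemma cdim_le_iff: "cdim V \<le> enat k \<longleftrightarrow> (\<exists>F. finite F \<and> card F \<le> k \<and> V \<subseteq> cspan F)"
proof
  assume "cdim V \<le> enat k"
  then obtain F where F: "finite F" "V \<subseteq> cspan F" and k: "complex_vector.dim V \<le> k"
    by (auto simp: cdim_def split: if_splits)
  obtain B where B: "B \<subseteq> V" "complex_vector.independent B" "V \<subseteq> cspan B"
      "card B = complex_vector.dim V"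
    by (rule complex_vector.basis_exists)
  then have "finite B"
    using complex_vector.independent_span_bound[OF F(1) B(2)] F(2) by blast
  then show "\<exists>F. finite F \<and> card F \<le> k \<and> V \<subseteq> cspan F"
    using B k by auto
next
  assume "\<exists>F. finite F \<and> card F \<le> k \<and> V \<subseteq> cspan F"
  then show "cdim V \<le> enat k"
    by (auto simp: cdim_def intro: order_trans[OF complex_vector.dim_le_card])
qed

lemma cdim_finite_iff: "cdim V < \<infinity> \<longleftrightarrow> (\<exists>F. finite F \<and> V \<subseteq> cspan F)"
  by (auto simp: cdim_def)

lemma cdim_mono:
  assumes "V \<subseteq> W" shows "cdim V \<le> cdim W"
proof (cases "cdim W")
  case (enat k)
  then have "cdim W \<le> enat k" by simp
  then have "cdim V \<le> enat k"
    unfolding cdim_le_iff using assms by blast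
  then show ?thesis using enat by simp
qed simp

text \<open>A basis \<open>C\<close> of the kernel extends to a basis \<open>B\<close> of
  \<open>V\<close>, and \<open>f\<close> maps \<open>B - C\<close> bijectively to a basis of the
  image. Addition in \<open>enat\<close> covers the infinite cases.\<close>

lemma cdim_rank_nullity:
  assumes V: "csubspace V" and f: "clinear f"
  shows "cdim V = cdim {x \<in> V. f x = 0} + cdim (f ` V)"
proof -
  interpret f: module_hom scaleC scaleC f by (fact f)
  define K where "K = {x \<in> V. f x = 0}"
  have K: "csubspace K"
    unfolding K_def using V f.subspace_kernel complex_vector.subspace_inter[of V "{x. f x = 0}"]
    by (simp add: Int_def)
  obtain C where C: "C \<subseteq> K" "complex_vector.independent C" "K \<subseteq> cspan C"
    by (rule complex_vector.basis_exists)
  have spC: "cspan C = K"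
    using C K by (metis complex_vector.span_subspace)
  have "C \<subseteq> V" using C(1) by (auto simp: K_def)
  then obtain B where B: "C \<subseteq> B" "B \<subseteq> V" "complex_vector.independent B" "V \<subseteq> cspan B"
    using complex_vector.maximal_independent_subset_extend[of C V] C(2) by blast
  have spB: "cspan B = V"
    using B V by (metis complex_vector.span_subspace)
  define E where "E = B - C"
  have E: "E \<subseteq> V" "complex_vector.independent E" "B = C \<union> E" "C \<inter> E = {}"
    using B complex_vector.independent_mono[OF B(3), of E] by (auto simp: E_def)
  \<comment> \<open>The coordinates of a common element with respect to \<open>B\<close> are
    supported both in \<open>C\<close> and in \<open>E\<close>, so all of them vanish.\<close>
  have disj: "cspan C \<inter> cspan E = {0}"
  proof -
    have "x = 0" if "x \<in> cspan C" "x \<in> cspan E" for x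
    proof -
      have "complex_vector.representation B x = complex_vector.representation C x"
        "complex_vector.representation B x = complex_vector.representation E x"
        using complex_vector.representation_extend[OF B(3) that(1) B(1)]
          complex_vector.representation_extend[OF B(3) that(2)] E(3) by blast+
      then have "complex_vector.representation B x b = 0" for b
        using complex_vector.representation_ne_zero[of C x b]
          complex_vector.representation_ne_zero[of E x b] E(4) by (metis disjoint_iff)
      then show ?thesis
        using complex_vector.sum_nonzero_representation_eq[OF B(3), of x] that B(1)
          complex_vector.span_mono[OF B(1)] by auto
    qed
    then show ?thesis using complex_vector.span_zero by blast
  qed
  have "cspan E \<subseteq> V"
    using E(1) V complex_vector.span_minimal by blast
  have inj: "inj_on f (cspan E)"
  proof (subst f.inj_on_iff_eq_0)
    show "\<forall>x\<in>cspan E. f x = 0 \<longrightarrow> x = 0"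
      using disj \<open>cspan E \<subseteq> V\<close> unfolding spC K_def by blast
  qed simp
  have indep: "complex_vector.independent (f ` E)"
    using f.independent_injective_image[OF E(2) inj] .
  have inj': "inj_on f E"
    using inj complex_vector.span_superset inj_on_subset by blast
  have "f ` V = cspan (f ` E)"
  proof -
    have "f ` C \<subseteq> {0}" using C(1) by (auto simp: K_def)
    then have "cspan (f ` B) = cspan (f ` E)"
      using subset_singletonD[of "f ` C" 0] unfolding E(3) image_Un by auto
    then show ?thesis
      using f.span_image[of B] spB by simp
  qed
  then have "cdim (f ` V) = (if finite E then enat (card E) else \<infinity>)"
    using cdim_cspan_independent[OF indep] inj' by (simp add: card_image finite_image_iff)
  moreover have "cdim K = (if finite C then enat (card C) else \<infinity>)"
    using cdim_cspan_independent[OF C(2)] spC by simp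
  moreover have "cdim V = (if finite B then enat (card B) else \<infinity>)"
    using cdim_cspan_independent[OF B(3)] spB by simp
  ultimately show ?thesis
    unfolding K_def[symmetric] using E by (simp add: card_Un_disjoint)
qed

lemma cdim_zero: "cdim {0} = 0"
proof -
  have "cdim {0} \<le> enat 0"
    unfolding cdim_le_iff by (auto intro!: exI[of _ "{}"])
  then show ?thesis by (metis zero_enat_def le_zero_eq)
qed

lemma cdim_image_inj:
  assumes "csubspace V" "clinear f" "\<And>x. x \<in> V \<Longrightarrow> f x = 0 \<Longrightarrow> x = 0"
  shows "cdim (f ` V) = cdim V"
proof -
  have "{x \<in> V. f x = 0} = {0}"
    using assms complex_vector.subspace_0[OF assms(1)] module_hom.zero[OF assms(2)] by auto
  then show ?thesis
    using cdim_rank_nullity[OF assms(1,2)] by (simp add: cdim_zero)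
qed

section \<open>Closed subspaces enlarged by finitely many vectors\<close>

lemma closed_cspan_insert:
  fixes S :: "'a::complex_hilbert set"
  assumes S: "closed S" "csubspace S"
  shows "closed (cspan (insert v S))"
proof -
  \<comment> \<open>Replacing \<open>v\<close> by its component \<open>w\<close> orthogonal to
    \<open>S\<close> does not change the span.\<close>
  define w where "w = v - proj S v"
  have w: "w \<in> orth_compl S"
    using proj_orth[OF S] by (simp add: w_def)
  have SS: "cspan S = S" using S(2) by simp
  have span_w: "cspan (insert v S) = cspan (insert w S)"
    using complex_vector.eq_span_insert_eq[of v w S] proj_in[OF S, of v]
    unfolding SS w_def by simp
  show ?thesis
  proof (cases "w = 0")
    case True
    then show ?thesis using S span_w by (simp add: complex_vector.span_eq_iff[THEN iffD2])
  next
    case False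
    \<comment> \<open>\<open>g\<close> removes the component along \<open>w\<close>. It is
      continuous, and the enlarged span is the preimage of \<open>S\<close> under it.\<close>
    define g where "g x = x - (cinner x w / cinner w w) *\<^sub>C w" for x
    have cont: "continuous_on UNIV g"
      unfolding g_def using False by (intro continuous_intros) (auto simp: cinner_self_eq_0)
    have "cspan (insert w S) = g -` S"
    proof -
      have "x \<in> cspan (insert w S) \<longleftrightarrow> g x \<in> S" for x
      proof
        assume "x \<in> cspan (insert w S)"
        then obtain k where k: "x - k *\<^sub>C w \<in> S"
          unfolding complex_vector.span_insert SS by blast
        then have "cinner (x - k *\<^sub>C w) w = 0"
          using orth_complD[OF w] by blast
        then have "k = cinner x w / cinner w w"
          using False by (simp add: cinner_simps cinner_self_eq_0 field_simps)
        then show "g x \<in> S" using k by (simp add: g_def)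
      next
        assume "g x \<in> S"
        then show "x \<in> cspan (insert w S)"
          unfolding complex_vector.span_insert SS g_def by blast
      qed
      then show ?thesis by auto
    qed
    then show ?thesis
      using closed_vimage[OF S(1) cont] span_w by simp
  qed
qed

lemma closed_cspan_Un_finite:
  fixes S :: "'a::complex_hilbert set"
  assumes S: "closed S" "csubspace S" and F: "finite F"
  shows "closed (cspan (S \<union> F))"
  using F
proof (induction F)
  case empty
  show ?case using S by (simp add: complex_vector.span_eq_iff[THEN iffD2])
next
  case (insert v F)
  have "cspan (S \<union> insert v F) = cspan (insert v (cspan (S \<union> F)))"
  proof -
    have "cspan (insert v (cspan (S \<union> F))) = cspan (insert v (S \<union> F))"
      unfolding complex_vector.span_insert complex_vector.span_span ..
    then show ?thesis by simp
  qed
  then show ?case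
    using closed_cspan_insert[OF insert.IH complex_vector.subspace_span] by simp
qed

lemma closed_csubspace_finite_dim:
  fixes V :: "'a::complex_hilbert set"
  assumes V: "csubspace V" and fin: "cdim V < \<infinity>"
  shows "closed V"
proof -
  obtain B where B: "B \<subseteq> V" "complex_vector.independent B" "V \<subseteq> cspan B"
    by (rule complex_vector.basis_exists)
  have "V = cspan B" using B V by (metis complex_vector.span_subspace)
  then have "finite B"
    using cdim_cspan_independent[OF B(2)] fin by (auto split: if_splits)
  then have "closed (cspan ({0} \<union> B))"
    by (intro closed_cspan_Un_finite) auto
  then show ?thesis using \<open>V = cspan B\<close> by simp
qed

section \<open>Adjoints\<close>

text \<open>If \<open>f\<close> is nonzero, take \<open>w\<close> orthogonal to its kernel with
  \<open>f w\<close> nonzero. Every \<open>x\<close> equals \<open>(f x / f w) *\<^sub>C w\<close>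
  modulo the kernel, and pairing with \<open>w\<close> recovers \<open>f x\<close>.\<close>

lemma riesz_representation:
  fixes f :: "'a::complex_hilbert \<Rightarrow> complex"
  assumes add: "\<And>x y. f (x + y) = f x + f y" and scale: "\<And>c x. f (c *\<^sub>C x) = c * f x"
    and cont: "continuous_on UNIV f"
  shows "\<exists>z. \<forall>x. f x = cinner x z"
proof (cases "\<forall>x. f x = 0")
  case True
  then show ?thesis by (intro exI[of _ 0]) (simp add: cinner_simps)
next
  case False
  then obtain u where u: "f u \<noteq> 0" by blast
  define S where "S = {x. f x = 0}"
  have f: "clinear f" using add scale by (intro clinearI) (auto simp: scaleC_complex_def)
  have S: "closed S" "csubspace S"
    unfolding S_def using module_hom.subspace_kernel[OF f]
    by (auto intro!: closed_Collect_eq continuous_intros cont)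
  define w where "w = u - proj S u"
  have w: "w \<in> orth_compl S"
    using proj_orth[OF S] by (simp add: w_def)
  have "f w = f u"
    using proj_in[OF S, of u] module_hom.diff[OF f] by (simp add: w_def S_def)
  then have fw: "f w \<noteq> 0" using u by simp
  then have w0: "cinner w w \<noteq> 0"
    using cinner_self_eq_0[of w] module_hom.zero[OF f] by auto
  have "f x = cinner x ((cnj (f w) / cinner w w) *\<^sub>C w)" for x
  proof -
    have "f (x - (f x / f w) *\<^sub>C w) = 0"
      using fw by (simp add: module_hom.diff[OF f] scale)
    then have "cinner (x - (f x / f w) *\<^sub>C w) w = 0"
      using orth_complD[OF w] by (simp add: S_def)
    then have "cinner x w = f x / f w * cinner w w"
      by (simp add: cinner_simps)
    moreover have "cnj (cinner w w) = cinner w w"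
      by (metis cinner_commute)
    ultimately show ?thesis
      using fw w0 by (simp add: cinner_simps)
  qed
  then show ?thesis by blast
qed

definition adj :: "('a::complex_hilbert \<Rightarrow>\<^sub>L 'a) \<Rightarrow> ('a \<Rightarrow>\<^sub>L 'a)"
  where "adj A = (SOME C. C \<in> bounded_ops \<and> (\<forall>x y. cinner (A x) y = cinner x (C y)))"

lemma clinear_bounded_op: "A \<in> bounded_ops \<Longrightarrow> clinear (blinfun_apply A)"
  by (intro clinearI) (auto simp: bounded_ops_def blinfun.add_right)

text \<open>Putting \<open>x = z\<close> turns the square of \<open>norm z\<close> into
  \<open>cinner (A z) y\<close>. The bound serves both for the boundedness of the adjoint and for
  its Lipschitz continuity in \<open>A\<close>.\<close>

lemma norm_le_if_adjoint:
  fixes A :: "'a::complex_hilbert \<Rightarrow>\<^sub>L 'a"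
  assumes "\<And>x. cinner (A x) y = cinner x z"
  shows "norm z \<le> norm A * norm y"
proof (cases "z = 0")
  case False
  have "complex_of_real ((norm z)\<^sup>2) = cinner (A z) y"
    by (simp only: assms cinner_self)
  then have "(norm z)\<^sup>2 = cmod (cinner (A z) y)"
    by (metis norm_of_real abs_of_nonneg zero_le_power2)
  also have "\<dots> \<le> norm A * norm z * norm y"
    by (meson cmod_cinner_le mult_right_mono norm_blinfun norm_ge_zero order_trans)
  finally show ?thesis
    using False by (simp add: power2_eq_square mult_ac)
qed simp

lemma adjoint_exists:
  assumes A: "A \<in> bounded_ops"
  shows "\<exists>C. C \<in> bounded_ops \<and> (\<forall>x y. cinner (A x) y = cinner x (C y))"
proof -
  have "\<exists>z. \<forall>x. cinner (A x) y = cinner x z" for y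
    using A by (intro riesz_representation continuous_intros)
      (auto simp: bounded_ops_def blinfun.add_right cinner_simps)
  then obtain h where h: "\<And>x y. cinner (A x) y = cinner x (h y)" by metis
  have h_add: "h (x + y) = h x + h y" for x y
    by (rule cinner_ext) (simp add: cinner_add_right flip: h)
  have h_scale: "h (c *\<^sub>C x) = c *\<^sub>C h x" for c x
    by (rule cinner_ext) (simp add: cinner_scaleC_right flip: h)
  have bl: "bounded_linear h"
  proof (rule bounded_linear_intro[where K = "norm A"])
    show "norm (h x) \<le> norm x * norm A" for x
      using norm_le_if_adjoint[of A x "h x"] h by (simp add: mult.commute)
  qed (simp_all add: h_add h_scale scaleR_scaleC)
  show ?thesis
    by (rule exI[of _ "Blinfun h"])
      (simp add: bounded_ops_def bounded_linear_Blinfun_apply[OF bl] h h_scale)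
qed

context
  fixes A :: "'a::complex_hilbert \<Rightarrow>\<^sub>L 'a"
  assumes A: "A \<in> bounded_ops"
begin

lemma adj_bounded_op: "adj A \<in> bounded_ops"
  and cinner_adj: "cinner (A x) y = cinner x (adj A y)"
  using someI_ex[OF adjoint_exists[OF A]] unfolding adj_def by blast+

lemma cinner_adj': "cinner x (A y) = cinner (adj A x) y"
  using cinner_adj[of y x] cinner_commute[of x "A y"] cinner_commute[of "adj A x" y] by simp

end

lemma adj_adj:
  assumes A: "A \<in> bounded_ops" shows "adj (adj A) = A"
proof (rule blinfun_eqI, rule cinner_ext)
  show "cinner x (adj (adj A) y) = cinner x (A y)" for x y
    using cinner_adj[OF adj_bounded_op[OF A], of x y] cinner_adj'[OF A, of x y] by simp
qed

lemma norm_adj_diff_le: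
  assumes "A \<in> bounded_ops" "B \<in> bounded_ops"
  shows "norm (adj A y - adj B y) \<le> norm (A - B) * norm y"
proof (rule norm_le_if_adjoint)
  show "cinner ((A - B) x) y = cinner x (adj A y - adj B y)" for x
    using cinner_adj[OF assms(1), of x y] cinner_adj[OF assms(2), of x y]
    by (simp add: blinfun.diff_left cinner_simps)
qed

lemma dist_adj_le:
  assumes "A \<in> bounded_ops" "B \<in> bounded_ops"
  shows "dist (adj A) (adj B) \<le> dist A B"
  unfolding dist_norm
  by (rule norm_blinfun_bound) (use norm_adj_diff_le[OF assms] in \<open>auto simp: blinfun.diff_left\<close>)

lemma continuous_on_adj: "continuous_on bounded_ops adj"
  unfolding continuous_on_iff using dist_adj_le by (meson order_le_less_trans)

lemma csubspace_op_range: "A \<in> bounded_ops \<Longrightarrow> csubspace (op_range A)"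
  using module_hom.subspace_image[OF clinear_bounded_op complex_vector.subspace_UNIV] .

lemma csubspace_null_space: "A \<in> bounded_ops \<Longrightarrow> csubspace (null_space A)"
  unfolding null_space_def using module_hom.subspace_kernel[OF clinear_bounded_op] .

lemma closed_null_space: "closed (null_space A)"
  unfolding null_space_def by (intro closed_Collect_eq continuous_intros)

lemma orth_compl_op_range:
  assumes A: "A \<in> bounded_ops" shows "orth_compl (op_range A) = null_space (adj A)"
proof -
  have "(\<forall>x. cinner x (adj A y) = 0) \<longleftrightarrow> adj A y = 0" for y
    using cinner_self_eq_0[of "adj A y"] by (auto simp: cinner_simps)
  then show ?thesis
    using cinner_adj[OF A] by (auto simp: orth_compl_def null_space_def)
qed

lemma closure_op_range:
  assumes "A \<in> bounded_ops" shows "closure (op_range A) = orth_compl (null_space (adj A))"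
  using orth_compl_orth_compl[of "closure (op_range A)"] assms
  by (simp add: orth_compl_closure csubspace_closure csubspace_op_range orth_compl_op_range)

section \<open>Operators with closed range\<close>

lemma closed_image_bounded_below:
  fixes A :: "'a::complex_hilbert \<Rightarrow>\<^sub>L 'a"
  assumes M: "closed M" "csubspace M" and "c > 0"
    and below: "\<And>x. x \<in> M \<Longrightarrow> c * norm x \<le> norm (A x)"
  shows "closed (blinfun_apply A ` M)"
proof -
  \<comment> \<open>The completeness lemma used next speaks of real subspaces.\<close>
  have "subspace M"
    using M(2) by (auto simp: subspace_def complex_vector.subspace_def scaleR_scaleC)
  then have "complete (blinfun_apply A ` M)"
    using M(1) assms below
    by (intro complete_isometric_image[where e = c]) (auto simp: blinfun.bounded_linear_right complete_eq_closed)
  then show ?thesis by (rule complete_imp_closed)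
qed

lemma op_range_eq_image_orth_compl:
  assumes A: "A \<in> bounded_ops"
  shows "op_range A = blinfun_apply A ` orth_compl (null_space A)"
proof -
  have "A x = A (x - proj (null_space A) x)" for x
    using proj_in[OF closed_null_space csubspace_null_space[OF A], of x]
    by (simp add: blinfun.diff_right null_space_def)
  then show ?thesis
    using proj_orth[OF closed_null_space csubspace_null_space[OF A]] by blast
qed

text \<open>For \<open>c > 0\<close> this says that the reduced minimum modulus of \<open>A\<close>,
  the infimum of \<open>norm (A x)\<close> over unit vectors \<open>x\<close> orthogonal to the
  kernel, is at least \<open>c\<close>. The kernel, which varies badly with \<open>A\<close>, does
  not occur in the formula.\<close>

definition gap_ops :: "real \<Rightarrow> ('a::complex_hilbert \<Rightarrow>\<^sub>L 'a) set"
  where "gap_ops c = {A \<in> bounded_ops. \<forall>x y. c * cmod (cinner (A x) y) \<le> norm (A x) * norm (adj A y)}"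

lemma adj_gap_ops:
  assumes "A \<in> gap_ops c" shows "adj A \<in> gap_ops c"
proof -
  have A: "A \<in> bounded_ops" using assms by (simp add: gap_ops_def)
  have "c * cmod (cinner (adj A x) y) \<le> norm (adj A x) * norm (A y)" for x y
  proof -
    have "cmod (cinner (adj A x) y) = cmod (cinner (A y) x)"
      by (metis cinner_adj'[OF A] cinner_commute complex_mod_cnj)
    then show ?thesis using assms by (simp add: gap_ops_def mult.commute)
  qed
  then show ?thesis by (simp add: gap_ops_def adj_bounded_op adj_adj A)
qed

text \<open>Moving \<open>A\<close> across the inner product gives a bound on
  \<open>cinner x z\<close> for all \<open>z\<close> in the range of the adjoint. By continuity it
  extends to the closure of that range, which contains \<open>x\<close>; then put
  \<open>z = x\<close>.\<close>

lemma gap_ops_bounded_below: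
  assumes A: "A \<in> gap_ops c" and x: "x \<in> orth_compl (null_space A)"
  shows "c * norm x \<le> norm (A x)"
proof (cases "x = 0")
  case False
  have A': "A \<in> bounded_ops" using A by (simp add: gap_ops_def)
  have "x \<in> closure (op_range (adj A))"
    using closure_op_range[OF adj_bounded_op[OF A']] x by (simp add: adj_adj A')
  also have "\<dots> \<subseteq> {z. c * cmod (cinner x z) \<le> norm (A x) * norm z}"
  proof (rule closure_minimal)
    show "op_range (adj A) \<subseteq> {z. c * cmod (cinner x z) \<le> norm (A x) * norm z}"
      using A by (auto simp: gap_ops_def cinner_adj)
    show "closed {z. c * cmod (cinner x z) \<le> norm (A x) * norm z}"
      by (intro closed_Collect_le continuous_intros)
  qed
  finally have "c * (norm x)\<^sup>2 \<le> norm (A x) * norm x"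
    by (simp add: cinner_self norm_power)
  then have "(c * norm x) * norm x \<le> norm (A x) * norm x"
    by (simp add: power2_eq_square mult.assoc)
  then show ?thesis
    using False by (simp only: mult_le_cancel_right) auto
qed simp

text \<open>Baire's theorem on the range, covered by the closed sets
  \<open>{z. \<forall>y. \<bar>\<langle>z, y\<rangle>\<bar> \<le> k \<parallel>A\<^sup>* y\<parallel>}\<close>.\<close>

lemma gap_if_closed_range:
  fixes A :: "'a::complex_hilbert \<Rightarrow>\<^sub>L 'a"
  assumes A: "A \<in> bounded_ops" and cl: "closed (op_range A)"
  shows "\<exists>c>0. A \<in> gap_ops c"
proof -
  let ?R = "op_range A"
  define F where "F k = {z \<in> ?R. \<forall>y. cmod (cinner z y) \<le> real k * norm (adj A y)}" for k
  have R: "csubspace ?R" by (rule csubspace_op_range[OF A])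
  have clF: "closedin (top_of_set ?R) (F k)" for k
  proof -
    have "F k = ?R \<inter> (\<Inter>y. {z. cmod (cinner z y) \<le> real k * norm (adj A y)})"
      by (auto simp: F_def)
    moreover have "closed (\<Inter>y. {z. cmod (cinner z y) \<le> real k * norm (adj A y)})"
      by (intro closed_INT ballI closed_Collect_le continuous_intros)
    ultimately show ?thesis by (simp add: closedin_closed_Int)
  qed
  have cover: "\<Union>(range F) = ?R"
  proof -
    have "A x \<in> \<Union>(range F)" for x
    proof -
      obtain k where k: "norm x \<le> real k" using real_arch_simple by blast
      have "cmod (cinner (A x) y) \<le> real k * norm (adj A y)" for y
      proof -
        have "cmod (cinner (A x) y) \<le> norm x * norm (adj A y)"
          unfolding cinner_adj[OF A] by (rule cmod_cinner_le)
        also have "\<dots> \<le> real k * norm (adj A y)"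
          using k by (simp add: mult_right_mono)
        finally show ?thesis .
      qed
      then show ?thesis by (auto simp: F_def)
    qed
    then show ?thesis by (auto simp: F_def)
  qed
  have "\<exists>k. top_of_set ?R interior_of F k \<noteq> {}"
  proof (rule ccontr)
    assume "\<not> ?thesis"
    then have "top_of_set ?R interior_of \<Union>(range F) = {}"
      using cl clF
      by (intro Baire_category_alt disjI1)
        (auto intro: completely_metrizable_space_closedin[OF completely_metrizable_space_euclidean])
    then show False
      using interior_of_topspace[of "top_of_set ?R"] unfolding cover by simp
  qed
  then obtain k z0 U where U: "openin (top_of_set ?R) U" "U \<subseteq> F k" "z0 \<in> U"
    by (auto simp: interior_of_def)
  then obtain r where r: "r > 0" "\<And>z. z \<in> ?R \<Longrightarrow> dist z z0 < r \<Longrightarrow> z \<in> F k"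
    by (meson openin_euclidean_subtopology_iff subsetD)
  have z0: "z0 \<in> F k" using U by blast
  \<comment> \<open>Both \<open>z0 + z\<close> and \<open>z0\<close> lie in \<open>F k\<close>, and
    subtracting their bounds costs the factor 2.\<close>
  have small: "cmod (cinner z y) \<le> 2 * real k * norm (adj A y)" if z: "z \<in> ?R" "norm z < r" for z y
  proof -
    have "z0 + z \<in> F k"
      using r(2)[of "z0 + z"] z z0 complex_vector.subspace_add[OF R] by (simp add: dist_norm F_def)
    then have "cmod (cinner (z0 + z) y) \<le> real k * norm (adj A y)"
      "cmod (cinner z0 y) \<le> real k * norm (adj A y)"
      using z0 by (simp_all add: F_def)
    moreover have "cmod (cinner z y) \<le> cmod (cinner (z0 + z) y) + cmod (cinner z0 y)"
      using norm_triangle_ineq4[of "cinner (z0 + z) y" "cinner z0 y"] by (simp add: cinner_simps)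
    ultimately show ?thesis by simp
  qed
  \<comment> \<open>Rescaling \<open>A x\<close> to norm \<open>r / 2\<close> and applying
    \<open>small\<close> gives the factor \<open>4 * k / r\<close>. Using \<open>k + 1\<close>
    instead of \<open>k\<close> avoids a division by zero.\<close>
  define c where "c = r / (4 * (real k + 1))"
  have "c > 0" using r(1) by (simp add: c_def)
  have "c * cmod (cinner (A x) y) \<le> norm (A x) * norm (adj A y)" for x y
  proof (cases "A x = 0")
    case False
    define t where "t = r / (2 * norm (A x))"
    have t: "t > 0" "norm (complex_of_real t *\<^sub>C A x) < r"
      using r(1) False by (simp_all add: t_def norm_scaleC norm_divide norm_mult)
    have "complex_of_real t *\<^sub>C A x \<in> ?R"
      using R complex_vector.subspace_scale by blast
    from small[OF this t(2)] have "t * cmod (cinner (A x) y) \<le> 2 * real k * norm (adj A y)"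
      using t(1) by (simp add: cinner_simps norm_mult)
    also have "\<dots> \<le> 2 * (real k + 1) * norm (adj A y)"
      by (intro mult_right_mono) auto
    finally show ?thesis
      using False r(1) by (simp add: t_def c_def field_simps)
  qed (simp add: cinner_simps)
  then show ?thesis
    using \<open>c > 0\<close> A by (auto simp: gap_ops_def)
qed

lemma closed_range_if_gap:
  assumes A: "A \<in> gap_ops c" and c: "c > 0"
  shows "closed (op_range A)"
proof -
  have A': "A \<in> bounded_ops" using A by (simp add: gap_ops_def)
  show ?thesis
    unfolding op_range_eq_image_orth_compl[OF A']
    using gap_ops_bounded_below[OF A]
    by (intro closed_image_bounded_below[OF closed_orth_compl csubspace_orth_compl c])
qed

lemma closed_range_iff_gap:
  "A \<in> bounded_ops \<Longrightarrow> closed (op_range A) \<longleftrightarrow> (\<exists>c>0. A \<in> gap_ops c)"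
  using gap_if_closed_range closed_range_if_gap by blast

lemma closed_op_range_adj_iff:
  assumes A: "A \<in> bounded_ops" shows "closed (op_range (adj A)) \<longleftrightarrow> closed (op_range A)"
  using adj_gap_ops[of A] adj_gap_ops[of "adj A"]
  by (auto simp: closed_range_iff_gap adj_bounded_op adj_adj A)

section \<open>Subspaces transversal to a closed subspace\<close>

text \<open>The elements of \<open>F\<close> are chosen greedily: each new image avoids the closed span of \<open>S\<close> and the
  previous images.\<close>

lemma exists_transversal:
  fixes A :: "'a::complex_hilbert \<Rightarrow>\<^sub>L 'a"
  assumes A: "A \<in> bounded_ops" and S: "closed S" "csubspace S"
    and big: "\<And>F. finite F \<Longrightarrow> card F < k \<Longrightarrow> \<not> blinfun_apply A ` D \<subseteq> cspan (S \<union> F)"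
  shows "\<exists>F \<delta>. finite F \<and> F \<subseteq> D \<and> card F = k \<and> complex_vector.independent F \<and> \<delta> > 0 \<and>
    (\<forall>v\<in>cspan F. \<forall>s\<in>S. \<delta> * norm v \<le> norm (A v - s))"
  using big
proof (induction k)
  case 0
  show ?case
    using complex_vector.independent_empty by (intro exI[of _ "{}"] exI[of _ 1]) auto
next
  case (Suc k)
  have "\<exists>F \<delta>. finite F \<and> F \<subseteq> D \<and> card F = k \<and> complex_vector.independent F \<and> \<delta> > 0 \<and>
      (\<forall>v\<in>cspan F. \<forall>s\<in>S. \<delta> * norm v \<le> norm (A v - s))"
    by (rule Suc.IH) (simp add: Suc.prems)
  then obtain F \<delta> where F: "finite F" "F \<subseteq> D" "card F = k" "complex_vector.independent F" "\<delta> > 0"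
    and below: "\<And>v s. v \<in> cspan F \<Longrightarrow> s \<in> S \<Longrightarrow> \<delta> * norm v \<le> norm (A v - s)"
    by blast
  define T where "T = cspan (S \<union> blinfun_apply A ` F)"
  have T: "closed T" "csubspace T"
    unfolding T_def using closed_cspan_Un_finite[OF S] F(1) by auto
  have ST: "S \<subseteq> T"
    using complex_vector.span_superset[of "S \<union> blinfun_apply A ` F"] by (simp add: T_def)
  have AT: "A u \<in> T" if "u \<in> cspan F" for u
  proof -
    have "A u \<in> cspan (blinfun_apply A ` F)"
      using module_hom.span_image[OF clinear_bounded_op[OF A]] that by blast
    then show ?thesis
      unfolding T_def using complex_vector.span_mono[of "blinfun_apply A ` F"] by blast
  qed
  have "card (blinfun_apply A ` F) < Suc k"
    using card_image_le[OF F(1), of A] F(3) by simp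
  then obtain f where f: "f \<in> D" "A f \<notin> T"
    using Suc.prems[of "blinfun_apply A ` F"] F(1) unfolding T_def by blast
  then obtain d where d: "d > 0" "\<And>t. t \<in> T \<Longrightarrow> d \<le> norm (A f - t)"
    using T(1) by (metis closure_closed closure_approachable dist_commute dist_norm not_le)
  have "f \<notin> cspan F" using AT f(2) by blast
  \<comment> \<open>With \<open>m = norm (A v - s)\<close> and \<open>v = u + a *\<^sub>C f\<close>,
    the estimates below bound \<open>cmod a\<close> by \<open>m / d\<close> and
    \<open>norm u\<close> by \<open>(m + m / d * norm (A f)) / \<delta>\<close>. Together they give
    \<open>norm v \<le> m * K\<close>.\<close>
  define K where "K = (1 + norm (A f) / d) / \<delta> + norm f / d"
  have K: "K > 0"
    using d(1) \<open>\<delta> > 0\<close> unfolding K_def by (intro add_pos_nonneg divide_pos_pos) auto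
  have "1 / K * norm v \<le> norm (A v - s)" if v: "v \<in> cspan (insert f F)" and s: "s \<in> S" for v s
  proof -
    obtain a where a: "v - a *\<^sub>C f \<in> cspan F"
      using v unfolding complex_vector.span_insert by blast
    define u where "u = v - a *\<^sub>C f"
    define m where "m = norm (A v - s)"
    have Av: "A v = A u + a *\<^sub>C A f"
      unfolding u_def using module_hom.diff[OF clinear_bounded_op[OF A]]
        module_hom.scale[OF clinear_bounded_op[OF A]] by simp
    \<comment> \<open>Dividing \<open>A v - s\<close> by \<open>a\<close> gives \<open>A f\<close>
      minus an element of \<open>T\<close>, which has norm at least \<open>d\<close>.\<close>
    have am: "cmod a * d \<le> m"
    proof (cases "a = 0")
      case False
      have "(1 / a) *\<^sub>C (s - A u) \<in> T"
        using ST s AT[of u] a T(2)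
        by (intro complex_vector.subspace_scale complex_vector.subspace_diff) (auto simp: u_def)
      then have "cmod a * d \<le> cmod a * norm (A f - (1 / a) *\<^sub>C (s - A u))"
        using d(2) by (simp add: mult_left_mono)
      also have "\<dots> = norm (a *\<^sub>C (A f - (1 / a) *\<^sub>C (s - A u)))"
        by (simp add: norm_scaleC)
      also have "a *\<^sub>C (A f - (1 / a) *\<^sub>C (s - A u)) = A v - s"
        using False by (simp add: complex_vector.scale_right_diff_distrib Av)
      finally show ?thesis by (simp add: m_def)
    qed (simp add: m_def)
    then have am': "cmod a \<le> m / d" using d(1) by (simp add: field_simps)
    have "\<delta> * norm u \<le> norm (A u - s)"
      using below[OF a s] by (simp add: u_def)
    also have "\<dots> \<le> m + cmod a * norm (A f)"
      using norm_triangle_ineq4[of "A v - s" "a *\<^sub>C A f"] by (simp add: Av m_def norm_scaleC)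
    also have "\<dots> \<le> m + m / d * norm (A f)"
      using mult_right_mono[OF am' norm_ge_zero[of "A f"]] by simp
    finally have u: "norm u \<le> (m + m / d * norm (A f)) / \<delta>"
      using \<open>\<delta> > 0\<close> by (simp add: field_simps)
    have "norm v \<le> norm u + cmod a * norm f"
      using norm_triangle_ineq[of u "a *\<^sub>C f"] by (simp add: u_def norm_scaleC)
    also have "\<dots> \<le> (m + m / d * norm (A f)) / \<delta> + m / d * norm f"
      using u am' by (intro add_mono mult_right_mono) auto
    also have "\<dots> = m * K"
      unfolding K_def by (simp add: algebra_simps add_divide_distrib)
    finally show ?thesis
      using K by (simp add: m_def field_simps)
  qed
  moreover have "complex_vector.independent (insert f F)"
    using F(4) \<open>f \<notin> cspan F\<close> complex_vector.independent_insertI by blast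
  moreover have "card (insert f F) = Suc k"
    using F(1,3) \<open>f \<notin> cspan F\<close> complex_vector.span_base by (metis card_insert_disjoint)
  ultimately show ?case
    using F f K by (intro exI[of _ "insert f F"] exI[of _ "1 / K"]) auto
qed

text \<open>The case \<open>S = {0}\<close> of \<open>exists_transversal\<close> gives a subspace of
  dimension \<open>k\<close> on which \<open>A\<close> is bounded below by some
  \<open>\<delta>\<close>. Every perturbation smaller than \<open>\<delta>\<close> stays injective
  there.\<close>

lemma rank_ge_open:
  assumes A: "A \<in> bounded_ops" and k: "enat k \<le> cdim (op_range A)"
  shows "\<exists>\<epsilon>>0. \<forall>B\<in>bounded_ops. norm (B - A) < \<epsilon> \<longrightarrow> enat k \<le> cdim (op_range B)"
proof -
  have "\<not> range A \<subseteq> cspan ({0} \<union> F)" if "finite F" "card F < k" for F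
  proof
    assume "range A \<subseteq> cspan ({0} \<union> F)"
    then have "cdim (op_range A) \<le> enat (card F)"
      unfolding cdim_le_iff using that by auto
    then have "enat k \<le> enat (card F)" using k by (rule order_trans[rotated])
    then show False using that(2) by simp
  qed
  then obtain F \<delta> where F: "finite F" "card F = k" "complex_vector.independent F" "\<delta> > 0"
    and below: "\<And>v. v \<in> cspan F \<Longrightarrow> \<delta> * norm v \<le> norm (A v)"
    using exists_transversal[OF A closed_singleton complex_vector.subspace_single_0, of k UNIV]
    by auto
  have "enat k \<le> cdim (op_range B)" if B: "B \<in> bounded_ops" "norm (B - A) < \<delta>" for B
  proof -
    have "v = 0" if v: "v \<in> cspan F" "B v = 0" for v
    proof (rule ccontr)
      assume "v \<noteq> 0"
      have "\<delta> * norm v \<le> norm ((B - A) v)"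
        using below[OF v(1)] v(2) by (simp add: blinfun.diff_left)
      also have "\<dots> \<le> norm (B - A) * norm v"
        by (rule norm_blinfun)
      also have "\<dots> < \<delta> * norm v"
        using B(2) \<open>v \<noteq> 0\<close> by simp
      finally show False by simp
    qed
    then have "cdim (blinfun_apply B ` cspan F) = cdim (cspan F)"
      by (intro cdim_image_inj clinear_bounded_op B) auto
    also have "\<dots> = enat k"
      using cdim_cspan_independent[OF F(3)] F by simp
    finally show ?thesis
      using cdim_mono[of "blinfun_apply B ` cspan F" "op_range B"] by auto
  qed
  then show ?thesis using F(4) by blast
qed

text \<open>Forward, \<open>exists_transversal\<close> is applied to the identity operator and the
  closure of the range. Backward, the lower bound makes \<open>cspan F\<close> meet that closure
  only in 0, so the projection onto the orthogonal complement is injective on it.\<close>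

lemma defect_ge_iff:
  fixes A :: "'a::complex_hilbert \<Rightarrow>\<^sub>L 'a"
  assumes A: "A \<in> bounded_ops" and D: "closure D = UNIV"
  shows "enat k \<le> cdim (orth_compl (op_range A)) \<longleftrightarrow>
    (\<exists>F n. finite F \<and> F \<subseteq> D \<and> card F = k \<and> complex_vector.independent F \<and>
      (\<forall>v\<in>cspan F. \<forall>x. norm v / real (Suc n) \<le> norm (v - A x)))"
    (is "?L \<longleftrightarrow> ?R")
proof -
  define S where "S = closure (op_range A)"
  have S: "closed S" "csubspace S"
    by (simp_all add: S_def csubspace_closure csubspace_op_range A)
  define Q where "Q = orth_compl (op_range A)"
  have Q: "closed Q" "csubspace Q" "orth_compl Q = S"
    using orth_compl_orth_compl[OF S]
    by (simp_all add: Q_def S_def closed_orth_compl csubspace_orth_compl orth_compl_closure)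
  have ran_proj: "proj Q ` V \<subseteq> Q" for V
    using proj_in[OF Q(1,2)] by blast
  show ?thesis
  proof
    assume ?L
    \<comment> \<open>The span of \<open>S\<close> and \<open>F\<close> is closed, so containing the
      dense set \<open>D\<close> it would be the whole space. Projecting onto \<open>Q\<close> kills
      \<open>S\<close> and leaves \<open>Q\<close> spanned by fewer than \<open>k\<close>
      vectors.\<close>
    have "\<not> blinfun_apply id_blinfun ` D \<subseteq> cspan (S \<union> F)" if F: "finite F" "card F < k" for F
    proof
      assume "blinfun_apply id_blinfun ` D \<subseteq> cspan (S \<union> F)"
      then have "closure D \<subseteq> cspan (S \<union> F)"
        using closed_cspan_Un_finite[OF S F(1)] by (intro closure_minimal) auto
      then have "Q \<subseteq> proj Q ` cspan (S \<union> F)"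
        using proj_eq_self_iff[OF Q(1,2)] D by (metis UNIV_I image_eqI subsetD subsetI)
      also have "\<dots> = cspan (proj Q ` S \<union> proj Q ` F)"
        by (simp add: module_hom.span_image[OF clinear_proj[OF Q(1,2)], symmetric] image_Un)
      also have "\<dots> \<subseteq> cspan (insert 0 (proj Q ` F))"
        using proj_eq_0_iff[OF Q(1,2)] Q(3) by (intro complex_vector.span_mono) auto
      finally have "Q \<subseteq> cspan (proj Q ` F)" by simp
      then have "cdim Q \<le> enat (card F)"
        unfolding cdim_le_iff using F(1) card_image_le[OF F(1)] by blast
      then have "enat k \<le> enat (card F)" using \<open>?L\<close> unfolding Q_def by (rule order_trans[rotated])
      then show False using F(2) by simp
    qed
    moreover have "id_blinfun \<in> bounded_ops"
      by (simp add: bounded_ops_def)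
    ultimately have "\<exists>F \<delta>. finite F \<and> F \<subseteq> D \<and> card F = k \<and> complex_vector.independent F \<and> \<delta> > 0 \<and>
        (\<forall>v\<in>cspan F. \<forall>s\<in>S. \<delta> * norm v \<le> norm (v - s))"
      using exists_transversal[OF _ S, of id_blinfun k D] by simp
    then obtain F \<delta> where F: "finite F" "F \<subseteq> D" "card F = k" "complex_vector.independent F"
        "\<delta> > 0" and below: "\<And>v s. v \<in> cspan F \<Longrightarrow> s \<in> S \<Longrightarrow> \<delta> * norm v \<le> norm (v - s)"
      by blast
    \<comment> \<open>Bounds of the form \<open>1 / real (Suc n)\<close> leave only countably many
      conditions when \<open>D\<close> is countable.\<close>
    obtain n where n: "1 / real (Suc n) < \<delta>"
      using \<open>\<delta> > 0\<close> nat_approx_posE by blast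
    have "norm v / real (Suc n) \<le> norm (v - A x)" if "v \<in> cspan F" for v x
    proof -
      have "norm v / real (Suc n) \<le> \<delta> * norm v"
        using mult_right_mono[OF less_imp_le[OF n], of "norm v"] by simp
      also have "\<dots> \<le> norm (v - A x)"
        using below[OF that] closure_subset[of "op_range A"] by (auto simp: S_def)
      finally show ?thesis .
    qed
    then show ?R using F by blast
  next
    assume ?R
    then obtain F n where F: "finite F" "card F = k" "complex_vector.independent F"
      and below: "\<And>v x. v \<in> cspan F \<Longrightarrow> norm v / real (Suc n) \<le> norm (v - A x)"
      by blast
    have "v = 0" if v: "v \<in> cspan F" "proj Q v = 0" for v
    proof -
      have "v \<in> closure (op_range A)"
        using v(2) proj_eq_0_iff[OF Q(1,2)] Q(3) by (simp add: S_def)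
      moreover have "closure (op_range A) \<subseteq> {s. norm v / real (Suc n) \<le> norm (v - s)}"
        using below[OF v(1)] by (intro closure_minimal closed_Collect_le continuous_intros) auto
      ultimately show ?thesis
        by (auto simp: divide_le_0_iff)
    qed
    then have "cdim (proj Q ` cspan F) = cdim (cspan F)"
      by (intro cdim_image_inj clinear_proj Q) auto
    also have "\<dots> = enat k"
      using cdim_cspan_independent[OF F(3)] F by simp
    finally show ?L
      using cdim_mono[OF ran_proj[of "cspan F"]] by (simp add: Q_def)
  qed
qed

section \<open>Stability of the index\<close>

text \<open>With \<open>M = N(A)\<^sup>\<bottom>\<close> and \<open>Q = R(A)\<^sup>\<bottom>\<close>, the space is the direct sum of \<open>B M\<close> and \<open>Q\<close>. The subspace
  \<open>V = {x. B x \<in> Q}\<close> projects isomorphically onto \<open>N(A)\<close>, and \<open>B\<close> maps it onto \<open>R(B) \<inter> Q\<close> with kernel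
  \<open>N(B)\<close>; the projection onto \<open>R(B)\<^sup>\<bottom>\<close> maps \<open>Q\<close> onto \<open>R(B)\<^sup>\<bottom>\<close> with kernel \<open>R(B) \<inter> Q\<close>. Hence both
  sides of the index formula are equal.\<close>

lemma semi_fredholm_stable:
  fixes A B :: "'a::complex_hilbert \<Rightarrow>\<^sub>L 'a"
  assumes A: "A \<in> gap_ops c" and B: "B \<in> bounded_ops" and near: "norm (B - A) < c"
    and fin: "cdim (null_space A) < \<infinity>"
  shows "closed (op_range B)" (is ?closed)
    and "cdim (null_space B) \<le> cdim (null_space A)" (is ?le)
    and "cdim (orth_compl (op_range B)) + cdim (null_space A) =
      cdim (orth_compl (op_range A)) + cdim (null_space B)" (is ?index)
proof -
  have A': "A \<in> bounded_ops" using A by (simp add: gap_ops_def)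
  have c: "c > 0" using near norm_ge_zero[of "B - A"] by linarith
  define N where "N = null_space A"
  define M where "M = orth_compl N"
  define R where "R = op_range A"
  define Q where "Q = orth_compl R"
  have N: "closed N" "csubspace N"
    using A' by (simp_all add: N_def closed_null_space csubspace_null_space)
  have M: "closed M" "csubspace M" by (simp_all add: M_def closed_orth_compl csubspace_orth_compl)
  have R: "closed R" "csubspace R"
    using A A' c closed_range_if_gap csubspace_op_range by (auto simp: R_def)
  have Q: "closed Q" "csubspace Q" by (simp_all add: Q_def closed_orth_compl csubspace_orth_compl)
  have Abelow: "c * norm x \<le> norm (A x)" if "x \<in> M" for x
    using gap_ops_bounded_below[OF A] that by (simp add: M_def N_def)
  have AM: "R = blinfun_apply A ` M"
    using op_range_eq_image_orth_compl[OF A'] by (simp add: R_def M_def N_def)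
  interpret B: module_hom scaleC scaleC "blinfun_apply B"
    by (rule clinear_bounded_op[OF B])
  have diff_le: "norm ((B - A) x) \<le> norm (B - A) * norm x" for x
    by (rule norm_blinfun)

  \<comment> \<open>Since \<open>B x\<close> is orthogonal to \<open>A x\<close>, the square of
    \<open>norm (A x)\<close> is at most \<open>norm (A x) * norm ((B - A) x)\<close>. Hence
    \<open>norm (A x)\<close> is below \<open>c * norm x\<close>, against the lower bound on
    \<open>M\<close>.\<close>
  have trivial: "x = 0" if x: "x \<in> M" "B x \<in> Q" for x
  proof (rule ccontr)
    assume "x \<noteq> 0"
    have "cinner (A x) (B x) = 0"
      using x(2) by (simp add: Q_def R_def orth_compl_def)
    then have "complex_of_real ((norm (A x))\<^sup>2) = - cinner (A x) ((B - A) x)"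
      unfolding cinner_self[symmetric] by (simp add: blinfun.diff_left cinner_simps)
    then have "(norm (A x))\<^sup>2 = cmod (cinner (A x) ((B - A) x))"
      by (metis norm_minus_cancel norm_of_real abs_of_nonneg zero_le_power2)
    also have "\<dots> \<le> norm (A x) * norm ((B - A) x)"
      by (rule cmod_cinner_le)
    finally have "norm (A x) * norm (A x) \<le> norm (A x) * norm ((B - A) x)"
      by (simp add: power2_eq_square)
    moreover have "norm (A x) > 0"
      using Abelow[OF x(1)] c \<open>x \<noteq> 0\<close> by (smt (verit) mult_pos_pos zero_less_norm_iff)
    ultimately have "norm (A x) \<le> norm ((B - A) x)" by simp
    also have "\<dots> \<le> norm (B - A) * norm x" by (rule diff_le)
    also have "\<dots> < c * norm x" using near \<open>x \<noteq> 0\<close> by simp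
    finally show False using Abelow[OF x(1)] by simp
  qed

  text \<open>The required \<open>x\<close> solves \<open>A x = P (h - (B - A) x)\<close>, \<open>P\<close> the projection onto \<open>R\<close>.\<close>
  have sum: "\<exists>x\<in>M. h - B x \<in> Q" for h
  proof -
    have "\<forall>r\<in>R. \<exists>x. x \<in> M \<and> A x = r"
      unfolding AM by blast
    then obtain J where J: "\<And>r. r \<in> R \<Longrightarrow> J r \<in> M \<and> A (J r) = r"
      by metis
    \<comment> \<open>\<open>J\<close> inverts \<open>A\<close> from \<open>R\<close> to
      \<open>M\<close> with Lipschitz constant \<open>1 / c\<close>, so \<open>T\<close> contracts
      by the ratio \<open>norm (B - A) / c\<close>. Its fixed point solves the equation.\<close>
    define T where "T x = J (proj R (h - (B - A) x))" for x
    have T: "T x \<in> M" "A (T x) = proj R (h - (B - A) x)" for x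
      using J[OF proj_in[OF R]] by (simp_all add: T_def)
    have "dist (T x) (T y) \<le> norm (B - A) / c * dist x y" for x y
    proof -
      have "c * norm (T x - T y) \<le> norm (A (T x - T y))"
        by (intro Abelow complex_vector.subspace_diff M T)
      also have "A (T x - T y) = proj R (h - (B - A) x) - proj R (h - (B - A) y)"
        by (simp add: blinfun.diff_right T)
      also have "\<dots> = proj R ((B - A) (y - x))"
        by (simp add: module_hom.diff[OF clinear_proj[OF R], symmetric] blinfun.diff_right)
      also have "norm \<dots> \<le> norm ((B - A) (y - x))"
        by (rule norm_proj_le[OF R])
      also have "\<dots> \<le> norm (B - A) * norm (x - y)"
        using diff_le by (metis norm_minus_commute)
      finally show ?thesis
        using c by (simp add: dist_norm field_simps)
    qed
    then have "\<exists>!x. T x = x"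
      using near c by (intro banach_fix_type[of "norm (B - A) / c"]) auto
    then obtain x where x: "T x = x" by blast
    have "proj R (h - B x) = proj R (h - (B - A) x) - proj R (A x)"
      by (simp add: module_hom.diff[OF clinear_proj[OF R], symmetric] blinfun.diff_left)
    also have "proj R (A x) = A x"
      by (simp add: proj_eq_self_iff[OF R]) (simp add: R_def)
    also have "proj R (h - (B - A) x) = A x"
      using T(2)[of x] x by simp
    finally have "h - B x \<in> Q"
      using proj_eq_0_iff[OF R] by (simp add: Q_def)
    then show ?thesis using T(1)[of x] x by auto
  qed

  have closed_BM: "closed (blinfun_apply B ` M)"
  proof (rule closed_image_bounded_below[OF M, of "c - norm (B - A)"])
    show "(c - norm (B - A)) * norm x \<le> norm (B x)" if "x \<in> M" for x
      using Abelow[OF that] diff_le[of x] norm_triangle_ineq4[of "B x" "(B - A) x"]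
      by (simp add: blinfun.diff_left left_diff_distrib)
  qed (use near in simp)
  show ?closed
  proof -
    obtain F where F: "finite F" "N \<subseteq> cspan F"
      using fin unfolding cdim_finite_iff N_def by blast
    obtain E where E: "E \<subseteq> N" "complex_vector.independent E" "N \<subseteq> cspan E"
      by (rule complex_vector.basis_exists)
    have "finite E"
      using complex_vector.independent_span_bound[OF F(1) E(2)] E(1) F(2) by blast
    \<comment> \<open>The range of \<open>B\<close> is the closed space \<open>B M\<close> enlarged
      by the images of a finite basis of \<open>N\<close>.\<close>
    have "op_range B = cspan (blinfun_apply B ` M \<union> blinfun_apply B ` E)"
    proof -
      have "x \<in> cspan (M \<union> E)" for x
      proof -
        have "proj N x \<in> cspan (M \<union> E)"
          using proj_in[OF N, of x] E(3) complex_vector.span_mono[of E "M \<union> E"] by blast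
        moreover have "x - proj N x \<in> cspan (M \<union> E)"
          using proj_orth[OF N, of x] complex_vector.span_base[of _ "M \<union> E"] by (simp add: M_def)
        ultimately show ?thesis
          using complex_vector.span_add by fastforce
      qed
      then have "cspan (M \<union> E) = UNIV" by blast
      then show ?thesis
        using B.span_image[of "M \<union> E"] by (simp add: image_Un)
    qed
    then show ?thesis
      using closed_cspan_Un_finite[OF closed_BM B.subspace_image[OF M(2)]] \<open>finite E\<close> by simp
  qed

  define V where "V = {x. B x \<in> Q}"
  define W where "W = op_range B \<inter> Q"
  have V: "csubspace V" unfolding V_def by (rule B.subspace_linear_preimage[OF Q(2)])
  have projV: "proj N ` V = N"
  proof
    show "proj N ` V \<subseteq> N" using proj_in[OF N] by blast
    show "N \<subseteq> proj N ` V"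
    proof
      fix z assume z: "z \<in> N"
      \<comment> \<open>Splitting \<open>B z\<close> along \<open>B M\<close> and \<open>Q\<close>
        corrects \<open>z\<close> by an element of \<open>M\<close>, which the projection onto
        \<open>N\<close> does not see.\<close>
      obtain u where u: "u \<in> M" "B z - B u \<in> Q" using sum by blast
      have "proj N (z - u) = z"
        using u(1) z proj_eq_0_iff[OF N, of u] proj_eq_self_iff[OF N, of z]
        by (simp add: M_def module_hom.diff[OF clinear_proj[OF N]])
      moreover have "z - u \<in> V"
        using u(2) by (simp add: V_def blinfun.diff_right)
      ultimately show "z \<in> proj N ` V" by force
    qed
  qed
  \<comment> \<open>The kernel of the projection on \<open>V\<close> is the intersection of
    \<open>V\<close> and \<open>M\<close>, which is zero by \<open>trivial\<close>.\<close>
  have "cdim (proj N ` V) = cdim V"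
    using trivial proj_eq_0_iff[OF N]
    by (intro cdim_image_inj V clinear_proj N) (auto simp: V_def M_def)
  moreover have "{x \<in> V. B x = 0} = null_space B"
    using complex_vector.subspace_0[OF Q(2)] by (auto simp: V_def null_space_def)
  moreover have "blinfun_apply B ` V = W"
    by (auto simp: V_def W_def)
  ultimately have dimN: "cdim N = cdim (null_space B) + cdim W"
    using cdim_rank_nullity[OF V B.module_hom_axioms] projV by simp
  show ?le
    using dimN by (simp add: N_def)

  define C where "C = orth_compl (op_range B)"
  have C: "closed C" "csubspace C" by (simp_all add: C_def closed_orth_compl csubspace_orth_compl)
  \<comment> \<open>The projection onto \<open>C\<close> kills the closure of the range of
    \<open>B\<close>, which is the range itself by the first claim.\<close>
  have kerC: "proj C x = 0 \<longleftrightarrow> x \<in> op_range B" for x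
    using proj_eq_0_iff[OF C] orth_compl_orth_compl[OF \<open>?closed\<close> csubspace_op_range[OF B]]
    by (simp add: C_def)
  have projQ: "proj C ` Q = C"
  proof
    show "proj C ` Q \<subseteq> C" using proj_in[OF C] by blast
    show "C \<subseteq> proj C ` Q"
    proof
      fix z assume z: "z \<in> C"
      obtain u where u: "z - B u \<in> Q" using sum by blast
      have "proj C (z - B u) = z"
        using z kerC[of "B u"] proj_eq_self_iff[OF C, of z]
        by (simp add: module_hom.diff[OF clinear_proj[OF C]])
      then show "z \<in> proj C ` Q" using u by force
    qed
  qed
  have "{x \<in> Q. proj C x = 0} = W" by (auto simp: W_def kerC)
  then have dimQ: "cdim Q = cdim W + cdim C"
    using cdim_rank_nullity[OF Q(2) clinear_proj[OF C]] projQ by simp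
  show ?index
    using dimN dimQ by (simp add: N_def Q_def R_def C_def ac_simps)
qed

section \<open>Descriptive classes in the norm topology\<close>

lemma topspace_norm_topology [simp]: "topspace norm_topology = bounded_ops"
  by (simp add: norm_topology_def)

lemma metrizable_norm_topology: "metrizable_space norm_topology"
  unfolding norm_topology_def
  by (intro metrizable_space_subtopology metrizable_space_euclidean)

lemma openin_norm_topologyI:
  assumes "U \<subseteq> bounded_ops"
    and "\<And>A. A \<in> U \<Longrightarrow> \<exists>e>0. \<forall>B\<in>bounded_ops. norm (B - A) < e \<longrightarrow> B \<in> U"
  shows "openin norm_topology U"
  using assms unfolding norm_topology_def openin_euclidean_subtopology_iff by (auto simp: dist_norm)

lemma fsigma_in_UN:
  "countable I \<Longrightarrow> (\<And>i. i \<in> I \<Longrightarrow> fsigma_in X (S i)) \<Longrightarrow> fsigma_in X (\<Union>i\<in>I. S i)"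
  by (rule fsigma_in_Union) auto

lemma closedin_bounded_ops_diff:
  "openin norm_topology U \<Longrightarrow> closedin norm_topology (bounded_ops - U)"
  using closedin_diff[OF closedin_topspace, of norm_topology U] by simp

section \<open>Borel sets of a topological space\<close>

lemma sigma_algebra_borel_in:
  "sigma_algebra (topspace X) (sigma_sets (topspace X) {U. openin X U})"
  by (rule sigma_algebra_sigma_sets) (use openin_subset in blast)

lemma borel_in_open: "openin X S \<Longrightarrow> borel_in X S"
  by (simp add: borel_in_def sigma_sets.Basic)

lemma borel_in_Diff: "borel_in X S \<Longrightarrow> borel_in X T \<Longrightarrow> borel_in X (S - T)"
  unfolding borel_in_def using sigma_algebra_borel_in
  by (rule ring_of_sets.Diff[OF algebra.axioms(1)[OF sigma_algebra.axioms(1)]])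

lemma borel_in_Int: "borel_in X S \<Longrightarrow> borel_in X T \<Longrightarrow> borel_in X (S \<inter> T)"
  using borel_in_Diff[of X S "S - T"] borel_in_Diff[of X S T] by (simp add: Diff_Diff_Int)

lemma borel_in_INT:
  assumes "\<And>i::nat. borel_in X (S i)" shows "borel_in X (\<Inter>i. S i)"
  using sigma_algebra.countable_INT[OF sigma_algebra_borel_in, of S UNIV X] assms
  by (simp add: borel_in_def image_subset_iff)

lemma borel_in_fsigma:
  assumes "fsigma_in X S" shows "borel_in X S"
proof -
  obtain C :: "nat \<Rightarrow> _" where C: "\<And>i. closedin X (C i)" "\<Union>(range C) = S"
    using assms unfolding fsigma_in_ascending by blast
  have "borel_in X (topspace X - (topspace X - C i))" for i
    using C(1) by (intro borel_in_Diff borel_in_open) auto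
  then have "borel_in X (C i)" for i
    using closedin_subset[OF C(1)] by (simp add: double_diff)
  then show ?thesis
    using sigma_sets.Union[of C "topspace X" "{U. openin X U}"] C(2) by (simp add: borel_in_def)
qed

section \<open>Preimages under the adjoint map\<close>

lemma continuous_map_adj: "continuous_map norm_topology norm_topology adj"
  unfolding norm_topology_def continuous_map_in_subtopology
  using continuous_on_adj adj_bounded_op by auto

text \<open>Taking adjoints exchanges nullity and defect, so preimage lemmas of this kind carry a
  result about one side over to the other.\<close>

lemma openin_adj_preimage:
  "openin norm_topology U \<Longrightarrow> openin norm_topology {A \<in> bounded_ops. adj A \<in> U}"
  using openin_continuous_map_preimage[OF continuous_map_adj] by simp

lemma fsigma_in_adj_preimage:
  assumes "fsigma_in norm_topology U"
  shows "fsigma_in norm_topology {A \<in> bounded_ops. adj A \<in> U}"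
proof -
  obtain C :: "nat \<Rightarrow> _" where C: "\<And>n. closedin norm_topology (C n)" "U = \<Union>(range C)"
    using assms unfolding fsigma_in_ascending by blast
  have "{A \<in> bounded_ops. adj A \<in> U} = (\<Union>n. {A \<in> bounded_ops. adj A \<in> C n})"
    using C(2) by auto
  moreover have "closedin norm_topology {A \<in> bounded_ops. adj A \<in> C n}" for n
    using closedin_continuous_map_preimage[OF continuous_map_adj C(1)] by simp
  ultimately show ?thesis
    by (simp add: fsigma_in_UN closed_imp_fsigma_in)
qed

lemma closedin_gap_ops: "closedin norm_topology (gap_ops c :: ('a::complex_hilbert \<Rightarrow>\<^sub>L 'a) set)"
proof -
  have "closedin norm_topology
      {A :: 'a \<Rightarrow>\<^sub>L 'a. A \<in> bounded_ops \<and> c * cmod (cinner (A x) y) \<le> norm (A x) * norm (adj A y)}"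
    for x y
  proof -
    have "continuous_on bounded_ops
        (\<lambda>A. norm (blinfun_apply A x) * norm (adj A y) - c * cmod (cinner (A x) y))"
      by (intro continuous_intros continuous_on_adj)
    from continuous_closedin_preimage[OF this closed_atLeast[of 0]]
    show ?thesis by (simp add: norm_topology_def vimage_def Int_def)
  qed
  then have "closedin norm_topology
      (\<Inter>x. \<Inter>y. {A :: 'a \<Rightarrow>\<^sub>L 'a. A \<in> bounded_ops \<and> c * cmod (cinner (A x) y) \<le> norm (A x) * norm (adj A y)})"
    by (intro closedin_INT) simp_all
  moreover have "gap_ops c =
      (\<Inter>x. \<Inter>y. {A :: 'a \<Rightarrow>\<^sub>L 'a. A \<in> bounded_ops \<and> c * cmod (cinner (A x) y) \<le> norm (A x) * norm (adj A y)})"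
    by (auto simp: gap_ops_def)
  ultimately show ?thesis by simp
qed

text \<open>Lower bounds are the building blocks: a finite exact value is a difference of two
  consecutive ones, and the value infinity is the intersection of all of them.\<close>

definition rank_ge :: "nat \<Rightarrow> ('a::complex_hilbert \<Rightarrow>\<^sub>L 'a) set"
  where "rank_ge k = {A \<in> bounded_ops. enat k \<le> cdim (op_range A)}"

definition defect_ge :: "nat \<Rightarrow> ('a::complex_hilbert \<Rightarrow>\<^sub>L 'a) set"
  where "defect_ge k = {A \<in> bounded_ops. enat k \<le> cdim (orth_compl (op_range A))}"

definition nullity_ge :: "nat \<Rightarrow> ('a::complex_hilbert \<Rightarrow>\<^sub>L 'a) set"
  where "nullity_ge k = {A \<in> bounded_ops. enat k \<le> cdim (null_space A)}"

lemma orth_compl_op_range_adj: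
  assumes A: "A \<in> bounded_ops" shows "orth_compl (op_range (adj A)) = null_space A"
  using orth_compl_op_range[OF adj_bounded_op[OF A]] by (simp add: adj_adj A)

lemma openin_rank_ge: "openin norm_topology (rank_ge k)"
  by (rule openin_norm_topologyI) (use rank_ge_open in \<open>auto simp: rank_ge_def\<close>)

lemma fsigma_defect_ge:
  assumes "separable_space (euclidean :: 'a::complex_hilbert topology)"
  shows "fsigma_in norm_topology (defect_ge k :: ('a \<Rightarrow>\<^sub>L 'a) set)"
proof -
  obtain D :: "'a set" where D: "countable D" "closure D = UNIV"
    using assms by (auto simp: separable_space_def)
  \<comment> \<open>A countable dense set has only countably many finite subsets, and each pair
    \<open>(F, n)\<close> imposes an intersection of closed conditions on \<open>A\<close>.\<close>
  define I where "I = {F. finite F \<and> F \<subseteq> D \<and> card F = k \<and> complex_vector.independent F} \<times> (UNIV :: nat set)"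
  define C :: "'a set \<times> nat \<Rightarrow> ('a \<Rightarrow>\<^sub>L 'a) set" where
    "C = (\<lambda>(F, n). bounded_ops \<inter> (\<Inter>v\<in>cspan F. \<Inter>x. {A. norm v / real (Suc n) \<le> norm (v - blinfun_apply A x)}))"
  have "countable {F. finite F \<and> F \<subseteq> D \<and> card F = k \<and> complex_vector.independent F}"
    by (rule countable_subset[OF _ countable_Collect_finite_subset[OF D(1)]]) auto
  then have "countable I" by (simp add: I_def)
  moreover have "closedin norm_topology (C p)" for p
  proof -
    have "closed (\<Inter>v\<in>cspan F. \<Inter>x. {A :: 'a \<Rightarrow>\<^sub>L 'a. norm v / real (Suc n) \<le> norm (v - blinfun_apply A x)})" for F n
      by (intro closed_INT ballI closed_Collect_le continuous_intros)
    then show ?thesis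
      unfolding C_def norm_topology_def by (cases p) (simp add: closedin_closed_Int)
  qed
  moreover have "defect_ge k = (\<Union>p\<in>I. C p)"
  proof (intro set_eqI)
    fix A :: "'a \<Rightarrow>\<^sub>L 'a"
    show "A \<in> defect_ge k \<longleftrightarrow> A \<in> (\<Union>p\<in>I. C p)"
    proof (cases "A \<in> bounded_ops")
      case True
      have "(\<exists>p\<in>I. A \<in> C p) \<longleftrightarrow> (\<exists>F n. (F, n) \<in> I \<and> A \<in> C (F, n))"
        by auto
      then show ?thesis
        using True defect_ge_iff[OF True D(2), of k] by (simp add: defect_ge_def I_def C_def conj_assoc)
    qed (auto simp: defect_ge_def C_def)
  qed
  ultimately show ?thesis
    by (simp add: fsigma_in_UN closed_imp_fsigma_in)
qed

lemma fsigma_nullity_ge: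
  assumes "separable_space (euclidean :: 'a::complex_hilbert topology)"
  shows "fsigma_in norm_topology (nullity_ge k :: ('a \<Rightarrow>\<^sub>L 'a) set)"
proof -
  have "nullity_ge k = {A \<in> bounded_ops. adj A \<in> (defect_ge k :: ('a \<Rightarrow>\<^sub>L 'a) set)}"
    by (auto simp: nullity_ge_def defect_ge_def orth_compl_op_range_adj adj_bounded_op)
  then show ?thesis
    using fsigma_in_adj_preimage[OF fsigma_defect_ge[OF assms]] by simp
qed

text \<open>\<open>P\<close> is a condition on nullity and defect. Its hypothesis matches what
  \<open>semi_fredholm_stable\<close> provides for nearby operators: the nullity can only drop and
  the index is constant, written additively because \<open>enat\<close> has no faithful
  subtraction.\<close>

lemma openin_semi_fredholm:
  assumes P: "\<And>j l j' l'. j < \<infinity> \<Longrightarrow> j' \<le> j \<Longrightarrow> l' + j = l + j' \<Longrightarrow> P j l \<Longrightarrow> P j' l'"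
  shows "openin norm_topology {A \<in> bounded_ops. closed (op_range A) \<and> cdim (null_space A) < \<infinity> \<and>
    P (cdim (null_space A)) (cdim (orth_compl (op_range A)))}"
    (is "openin _ ?U")
proof (rule openin_norm_topologyI)
  fix A assume A: "A \<in> ?U"
  then obtain c where c: "c > 0" "A \<in> gap_ops c"
    using closed_range_iff_gap by auto
  have "B \<in> ?U" if B: "B \<in> bounded_ops" "norm (B - A) < c" for B
  proof -
    have fin: "cdim (null_space A) < \<infinity>" using A by simp
    note stable = semi_fredholm_stable[OF c(2) B fin]
    show ?thesis
      using A B(1) stable(1) le_less_trans[OF stable(2) fin] P[OF fin stable(2,3)] by simp
  qed
  then show "\<exists>e>0. \<forall>B\<in>bounded_ops. norm (B - A) < e \<longrightarrow> B \<in> ?U"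
    using c(1) by blast
qed auto

lemma openin_closed_range_finite_nullity:
  "openin norm_topology {A \<in> bounded_ops. closed (op_range A) \<and> cdim (null_space A) < \<infinity>}"
  using openin_semi_fredholm[of "\<lambda>_ _. True"] by simp

lemma openin_closed_range_finite_defect:
  "openin norm_topology {A \<in> bounded_ops. closed (op_range A) \<and> cdim (orth_compl (op_range A)) < \<infinity>}"
proof -
  have eq: "{A \<in> bounded_ops. closed (op_range A) \<and> cdim (orth_compl (op_range A)) < \<infinity>} =
    {A \<in> bounded_ops. adj A \<in> {A \<in> bounded_ops. closed (op_range A) \<and> cdim (null_space A) < \<infinity>}}"
    by (auto simp: closed_op_range_adj_iff orth_compl_op_range adj_bounded_op)
  show ?thesis
    unfolding eq by (rule openin_adj_preimage[OF openin_closed_range_finite_nullity])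
qed

section \<open>The classes of operators\<close>

lemma infinite_rank_if_finite_nullity:
  fixes A :: "'a::complex_hilbert \<Rightarrow>\<^sub>L 'a"
  assumes inf: "cdim (UNIV :: 'a set) = \<infinity>" and A: "A \<in> bounded_ops"
    and fin: "cdim (null_space A) < \<infinity>"
  shows "cdim (op_range A) = \<infinity>"
  using cdim_rank_nullity[OF complex_vector.subspace_UNIV clinear_bounded_op[OF A]] inf fin
  by (cases "cdim (op_range A)") (auto simp: null_space_def)

text \<open>The adjoint has finite nullity, so its range is infinite-dimensional, and this range
  lies in the orthogonal complement of the kernel of \<open>A\<close>. On that complement
  \<open>A\<close> is injective with full range.\<close>

lemma infinite_rank_if_finite_defect:
  fixes A :: "'a::complex_hilbert \<Rightarrow>\<^sub>L 'a"
  assumes inf: "cdim (UNIV :: 'a set) = \<infinity>" and A: "A \<in> bounded_ops"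
    and fin: "cdim (orth_compl (op_range A)) < \<infinity>"
  shows "cdim (op_range A) = \<infinity>"
proof -
  let ?M = "orth_compl (null_space A)"
  have "op_range (adj A) \<subseteq> ?M"
    using closure_op_range[OF adj_bounded_op[OF A]] closure_subset[of "op_range (adj A)"]
    by (simp add: adj_adj A)
  moreover have "cdim (op_range (adj A)) = \<infinity>"
    using infinite_rank_if_finite_nullity[OF inf adj_bounded_op[OF A]] fin
    by (simp add: orth_compl_op_range A)
  ultimately have "cdim ?M = \<infinity>"
    using cdim_mono[of "op_range (adj A)" ?M] by simp
  moreover have "cdim (blinfun_apply A ` ?M) = cdim ?M"
    by (intro cdim_image_inj csubspace_orth_compl clinear_bounded_op A)
      (auto simp: null_space_def intro: orth_compl_Int)
  ultimately show ?thesis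
    using op_range_eq_image_orth_compl[OF A] by simp
qed

lemma Sigma1_eq:
  assumes inf: "cdim (UNIV :: 'a::complex_hilbert set) = \<infinity>" and "n < \<infinity> \<or> m < \<infinity>"
  shows "(Sigma1 n m :: ('a \<Rightarrow>\<^sub>L 'a) set) = {A \<in> bounded_ops. closed (op_range A) \<and>
    cdim (null_space A) = n \<and> cdim (orth_compl (op_range A)) = m}"
  using assms(2) infinite_rank_if_finite_nullity[OF inf] infinite_rank_if_finite_defect[OF inf]
  by (auto simp: Sigma1_def)

lemma Sigma1_adj:
  assumes inf: "cdim (UNIV :: 'a::complex_hilbert set) = \<infinity>" and nm: "n < \<infinity> \<or> m < \<infinity>"
  shows "(Sigma1 n m :: ('a \<Rightarrow>\<^sub>L 'a) set) = {A \<in> bounded_ops. adj A \<in> Sigma1 m n}"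
proof -
  have mn: "m < \<infinity> \<or> n < \<infinity>" using nm by blast
  show ?thesis
    unfolding Sigma1_eq[OF inf nm] Sigma1_eq[OF inf mn]
    by (auto simp: closed_op_range_adj_iff orth_compl_op_range adj_bounded_op adj_adj)
qed

lemma Sigma0_eq:
  "Sigma0 n m = {A \<in> bounded_ops. \<not> closed (op_range A) \<and>
    cdim (null_space A) = n \<and> cdim (orth_compl (op_range A)) = m}"
proof -
  have "cdim (closure (op_range A)) = \<infinity>" if "A \<in> bounded_ops" "\<not> closed (op_range A)"
    for A :: "'a \<Rightarrow>\<^sub>L 'a"
  proof -
    \<comment> \<open>A finite-dimensional subspace is closed.\<close>
    have "cdim (op_range A) = \<infinity>"
      using closed_csubspace_finite_dim[OF csubspace_op_range[OF that(1)]] that(2)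
      by (cases "cdim (op_range A)") auto
    then show ?thesis
      using cdim_mono[OF closure_subset[of "op_range A"]] by simp
  qed
  then show ?thesis by (auto simp: Sigma0_def)
qed

text \<open>With nullity \<open>j\<close> and defect \<open>l\<close>, the equation
  \<open>l + n = m + j\<close> says that the index is \<open>n - m\<close>. The lemma shows that
  this condition passes to nearby operators.\<close>

lemma enat_index_trans:
  fixes j j' l l' m n :: enat
  assumes "j < \<infinity>" "n < \<infinity>" "j' \<le> j" "l' + j = l + j'" "l + n = m + j"
  shows "l' + n = m + j'"
  using assms by (cases j; cases j'; cases l; cases l'; cases m; cases n) auto

lemma enat_index_cancel:
  fixes l m n :: enat
  assumes "n < \<infinity>" shows "l + n = m + n \<longleftrightarrow> l = m"
  using assms by (cases l; cases m; cases n) auto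

text \<open>Among the closed-range operators of finite nullity whose index is \<open>n - m\<close>,
  nullity at most \<open>n\<close> and nullity below \<open>n\<close> are open conditions. Their
  difference is the class, and for \<open>n = 0\<close> the second set is empty.\<close>

lemma Sigma1_finite_nullity:
  fixes n m :: enat
  assumes inf: "cdim (UNIV :: 'a::complex_hilbert set) = \<infinity>" and n: "n < \<infinity>"
  shows "F_Int_G_in norm_topology (Sigma1 n m :: ('a \<Rightarrow>\<^sub>L 'a) set)"
    and "n = 0 \<Longrightarrow> openin norm_topology (Sigma1 n m :: ('a \<Rightarrow>\<^sub>L 'a) set)"
proof -
  define U where "U Q = {A :: 'a \<Rightarrow>\<^sub>L 'a. A \<in> bounded_ops \<and> closed (op_range A) \<and> cdim (null_space A) < \<infinity> \<and>
    Q (cdim (null_space A)) \<and> cdim (orth_compl (op_range A)) + n = m + cdim (null_space A)}" for Q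
  have U: "openin norm_topology (U Q)" if "\<And>j j'. j' \<le> j \<Longrightarrow> Q j \<Longrightarrow> Q j'" for Q
    unfolding U_def
    by (rule openin_semi_fredholm[of "\<lambda>j l. Q j \<and> l + n = m + j"]) (use that n enat_index_trans in blast)
  have eq: "(Sigma1 n m :: ('a \<Rightarrow>\<^sub>L 'a) set) = U (\<lambda>j. j \<le> n) - U (\<lambda>j. j < n)"
  proof (intro set_eqI)
    fix A :: "'a \<Rightarrow>\<^sub>L 'a"
    show "A \<in> Sigma1 n m \<longleftrightarrow> A \<in> U (\<lambda>j. j \<le> n) - U (\<lambda>j. j < n)"
    proof (cases "cdim (null_space A) = n")
      case True
      then show ?thesis using n by (simp add: Sigma1_eq[OF inf] U_def enat_index_cancel)
    next
      case False
      then show ?thesis using n by (auto simp: Sigma1_eq[OF inf] U_def)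
    qed
  qed
  have le: "openin norm_topology (U (\<lambda>j. j \<le> n))"
    by (rule U) (rule order_trans)
  have less: "openin norm_topology (U (\<lambda>j. j < n))"
    by (rule U) (rule le_less_trans)
  have "Sigma1 n m = (bounded_ops - U (\<lambda>j. j < n)) \<inter> U (\<lambda>j. j \<le> n)"
    unfolding eq by (auto simp: U_def)
  moreover have "closedin norm_topology (bounded_ops - U (\<lambda>j. j < n))"
    by (rule closedin_bounded_ops_diff[OF less])
  ultimately show "F_Int_G_in norm_topology (Sigma1 n m :: ('a \<Rightarrow>\<^sub>L 'a) set)"
    unfolding F_Int_G_in_def using le by blast
  show "openin norm_topology (Sigma1 n m :: ('a \<Rightarrow>\<^sub>L 'a) set)" if "n = 0"
  proof -
    have "U (\<lambda>j. j < n) = {}" using that by (simp add: U_def)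
    then show ?thesis using eq le by simp
  qed
qed

lemma F_Int_G_in_adj_preimage:
  assumes "F_Int_G_in norm_topology U"
  shows "F_Int_G_in norm_topology {A \<in> bounded_ops. adj A \<in> U}"
proof -
  obtain F G where FG: "closedin norm_topology F" "openin norm_topology G" "U = F \<inter> G"
    using assms by (auto simp: F_Int_G_in_def)
  have "{A \<in> bounded_ops. adj A \<in> U} =
      {A \<in> bounded_ops. adj A \<in> F} \<inter> {A \<in> bounded_ops. adj A \<in> G}"
    using FG(3) by auto
  then show ?thesis
    unfolding F_Int_G_in_def
    using closedin_continuous_map_preimage[OF continuous_map_adj FG(1)] openin_adj_preimage[OF FG(2)]
    by auto
qed

text \<open>In a metrizable space open sets are F-sigma, so each open set in a descending
  representation of \<open>G\<close> can be absorbed into one \<open>S i\<close>.\<close>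

lemma fsigma_delta_inI:
  assumes X: "metrizable_space X" and S: "\<And>i::nat. fsigma_in X (S i)" and G: "gdelta_in X G"
  shows "fsigma_delta_in X ((\<Inter>i. S i) \<inter> G)"
proof -
  obtain C :: "nat \<Rightarrow> _" where C: "\<And>i. openin X (C i)" "\<Inter>(range C) = G"
    using G unfolding gdelta_in_descending by blast
  show ?thesis
    unfolding fsigma_delta_in_def
    using fsigma_in_Int[OF S open_imp_fsigma_in[OF X C(1)]] C(2)
    by (intro exI[of _ "\<lambda>i. S i \<inter> C i"]) auto
qed

section \<open>Countable forms of the defining conditions\<close>

lemma enat_eq_infinity_iff: "x = \<infinity> \<longleftrightarrow> (\<forall>k. enat k \<le> x)"
proof
  assume "\<forall>k. enat k \<le> x"
  then have "enat (Suc k) \<le> x" for k by blast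
  then show "x = \<infinity>" by (cases x) (auto simp: not_less_eq_eq[symmetric])
qed simp

lemma enat_eq_iff: "x = enat k \<longleftrightarrow> enat k \<le> x \<and> \<not> enat (Suc k) \<le> x"
  by (cases x) auto

text \<open>The sets \<open>gap_ops c\<close> grow as \<open>c\<close> decreases, so the union over
  all \<open>c > 0\<close> reduces to a countable one.\<close>

lemma closed_range_iff_gap_nat:
  assumes A: "A \<in> bounded_ops"
  shows "closed (op_range A) \<longleftrightarrow> (\<exists>j. A \<in> gap_ops (1 / real (Suc j)))"
proof
  assume "closed (op_range A)"
  then obtain c where c: "c > 0" "A \<in> gap_ops c" using closed_range_iff_gap[OF A] by blast
  obtain j where j: "1 / real (Suc j) < c" using c(1) nat_approx_posE by blast
  have "1 / real (Suc j) * cmod (cinner (A x) y) \<le> norm (A x) * norm (adj A y)" for x y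
    using mult_right_mono[OF less_imp_le[OF j], of "cmod (cinner (A x) y)"] c(2)
    unfolding gap_ops_def by (auto intro: order_trans)
  then show "\<exists>j. A \<in> gap_ops (1 / real (Suc j))"
    using A by (auto simp: gap_ops_def)
next
  assume "\<exists>j. A \<in> gap_ops (1 / real (Suc j))"
  then obtain j where "A \<in> gap_ops (1 / real (Suc j))" by blast
  then show "closed (op_range A)" by (rule closed_range_if_gap) simp
qed

theorem theorem5p4:
  fixes k :: nat and n m :: enat
  assumes separable: "separable_space (euclidean :: 'a::complex_hilbert topology)"
    and infinite_dim: "cdim (UNIV :: 'a set) = \<infinity>"
  shows "F_Int_G_in norm_topology (Sigma_rank k :: ('a \<Rightarrow>\<^sub>L 'a) set)
    \<and> (n < \<infinity> \<or> m < \<infinity> \<longrightarrow>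
        F_Int_G_in norm_topology (Sigma1 n m :: ('a \<Rightarrow>\<^sub>L 'a) set))
    \<and> (n = 0 \<or> m = 0 \<longrightarrow>
        openin norm_topology (Sigma1 n m :: ('a \<Rightarrow>\<^sub>L 'a) set))
    \<and> gdelta_in norm_topology (Sigma0 0 0 :: ('a \<Rightarrow>\<^sub>L 'a) set)
    \<and> (n < \<infinity> \<and> m < \<infinity> \<longrightarrow>
        fsigma_Int_gdelta_in norm_topology (Sigma0 n m :: ('a \<Rightarrow>\<^sub>L 'a) set))
    \<and> ((n = \<infinity> \<and> m < \<infinity>) \<or> (n < \<infinity> \<and> m = \<infinity>) \<longrightarrow>
        fsigma_delta_in norm_topology (Sigma0 n m :: ('a \<Rightarrow>\<^sub>L 'a) set))
    \<and> borel_in norm_topology (Sigma1 \<infinity> \<infinity> :: ('a \<Rightarrow>\<^sub>L 'a) set)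
    \<and> borel_in norm_topology (Sigma0 \<infinity> \<infinity> :: ('a \<Rightarrow>\<^sub>L 'a) set)"
proof (intro conjI impI)
  let ?X = "norm_topology :: ('a \<Rightarrow>\<^sub>L 'a) topology"
  let ?B = "bounded_ops :: ('a \<Rightarrow>\<^sub>L 'a) set"
  note fN = fsigma_nullity_ge[OF separable] and fD = fsigma_defect_ge[OF separable]
  have gN: "gdelta_in ?X (?B - nullity_ge i)" and gD: "gdelta_in ?X (?B - defect_ge i)" for i
    using fN fD by (simp_all add: fsigma_in_gdelta_in)
  \<comment> \<open>Among operators of finite nullity, those outside \<open>CN\<close> are exactly
    the ones whose range is not closed; likewise for finite defect and \<open>CD\<close>. Both sets
    are open, so their complements are closed and hence G-delta.\<close>
  define CN where "CN = {A :: 'a \<Rightarrow>\<^sub>L 'a. A \<in> bounded_ops \<and> closed (op_range A) \<and> cdim (null_space A) < \<infinity>}"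
  define CD where "CD = {A :: 'a \<Rightarrow>\<^sub>L 'a. A \<in> bounded_ops \<and> closed (op_range A) \<and>
    cdim (orth_compl (op_range A)) < \<infinity>}"
  have "openin ?X CN" "openin ?X CD"
    unfolding CN_def CD_def
    by (rule openin_closed_range_finite_nullity openin_closed_range_finite_defect)+
  then have gCN: "gdelta_in ?X (?B - CN)" and gCD: "gdelta_in ?X (?B - CD)"
    by (auto intro!: closed_imp_gdelta_in metrizable_norm_topology closedin_bounded_ops_diff)

  have "Sigma_rank k = (?B - rank_ge (Suc k)) \<inter> rank_ge k"
    by (auto simp: Sigma_rank_def rank_ge_def enat_eq_iff)
  moreover have "closedin ?X (?B - rank_ge (Suc k))"
    by (rule closedin_bounded_ops_diff[OF openin_rank_ge])
  ultimately show "F_Int_G_in ?X (Sigma_rank k)"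
    unfolding F_Int_G_in_def using openin_rank_ge by blast

  show "F_Int_G_in ?X (Sigma1 n m)" if nm: "n < \<infinity> \<or> m < \<infinity>"
  proof (cases "n < \<infinity>")
    case True
    then show ?thesis by (rule Sigma1_finite_nullity[OF infinite_dim])
  next
    case False
    \<comment> \<open>Here \<open>m\<close> is finite, so the adjoint side has finite
      nullity.\<close>
    then have "F_Int_G_in ?X (Sigma1 m n)" using nm Sigma1_finite_nullity[OF infinite_dim] by blast
    then show ?thesis
      unfolding Sigma1_adj[OF infinite_dim nm] by (rule F_Int_G_in_adj_preimage)
  qed

  show "openin ?X (Sigma1 n m)" if nm: "n = 0 \<or> m = 0"
  proof (cases "n = 0")
    case True
    then show ?thesis using Sigma1_finite_nullity[OF infinite_dim, of n] by simp
  next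
    case False
    then have "openin ?X (Sigma1 m n)" using nm Sigma1_finite_nullity[OF infinite_dim, of m] by simp
    moreover have "n < \<infinity> \<or> m < \<infinity>" using nm by (auto simp: zero_enat_def)
    ultimately show ?thesis
      using openin_adj_preimage Sigma1_adj[OF infinite_dim] by metis
  qed

  have Sigma0_finite: "Sigma0 (enat a) (enat b) = (nullity_ge a \<inter> defect_ge b) \<inter>
      ((?B - nullity_ge (Suc a)) \<inter> (?B - defect_ge (Suc b)) \<inter> (?B - CN))" for a b
    unfolding Sigma0_eq nullity_ge_def defect_ge_def CN_def by (auto simp: enat_eq_iff)
  have gdelta_part: "gdelta_in ?X ((?B - nullity_ge a) \<inter> (?B - defect_ge b) \<inter> (?B - CN))" for a b
    by (intro gdelta_in_Int gN gD gCN)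
  show "gdelta_in ?X (Sigma0 0 0)"
  proof -
    \<comment> \<open>Lower bounds by 0 always hold, so only the G-delta factor of
      \<open>Sigma0_finite\<close> remains.\<close>
    have "nullity_ge 0 = ?B" "defect_ge 0 = ?B"
      by (auto simp: nullity_ge_def defect_ge_def zero_enat_def[symmetric])
    then have "Sigma0 0 0 = (?B - nullity_ge (Suc 0)) \<inter> (?B - defect_ge (Suc 0)) \<inter> (?B - CN)"
      using Sigma0_finite[of 0 0] by (auto simp: zero_enat_def)
    then show ?thesis using gdelta_part by simp
  qed
  show "fsigma_Int_gdelta_in ?X (Sigma0 n m)" if nm: "n < \<infinity> \<and> m < \<infinity>"
  proof -
    obtain a b where "n = enat a" "m = enat b" using nm by auto
    then show ?thesis
      unfolding fsigma_Int_gdelta_in_def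
      using Sigma0_finite fsigma_in_Int[OF fN fD] gdelta_part by blast
  qed

  show "fsigma_delta_in ?X (Sigma0 n m)" if nm: "(n = \<infinity> \<and> m < \<infinity>) \<or> (n < \<infinity> \<and> m = \<infinity>)"
    using nm
  proof
    assume "n = \<infinity> \<and> m < \<infinity>"
    then obtain b where b: "n = \<infinity>" "m = enat b" by auto
    \<comment> \<open>The infinite nullity is an intersection over \<open>i\<close>, and the fixed
      lower bound on the defect is repeated in every term. The finite defect lets \<open>CD\<close>
      express that the range is not closed.\<close>
    have eq: "Sigma0 n m = (\<Inter>i. nullity_ge i \<inter> defect_ge b) \<inter> ((?B - defect_ge (Suc b)) \<inter> (?B - CD))"
      unfolding Sigma0_eq nullity_ge_def defect_ge_def CD_def b enat_eq_infinity_iff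
      by (auto simp: enat_eq_iff)
    show ?thesis
      unfolding eq
      by (intro fsigma_delta_inI metrizable_norm_topology fsigma_in_Int fN fD gdelta_in_Int gD gCD)
  next
    assume "n < \<infinity> \<and> m = \<infinity>"
    then obtain a where a: "n = enat a" "m = \<infinity>" by auto
    have eq: "Sigma0 n m = (\<Inter>i. nullity_ge a \<inter> defect_ge i) \<inter> ((?B - nullity_ge (Suc a)) \<inter> (?B - CN))"
      unfolding Sigma0_eq nullity_ge_def defect_ge_def CN_def a enat_eq_infinity_iff
      by (auto simp: enat_eq_iff)
    show ?thesis
      unfolding eq
      by (intro fsigma_delta_inI metrizable_norm_topology fsigma_in_Int fN fD gdelta_in_Int gN gCN)
  qed

  \<comment> \<open>With nullity and defect both infinite, closedness of the range is expressed by a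
    countable union of closed sets.\<close>
  define CR where "CR = (\<Union>j. gap_ops (1 / real (Suc j)) :: ('a \<Rightarrow>\<^sub>L 'a) set)"
  have CR: "A \<in> CR \<longleftrightarrow> closed (op_range A)" if "A \<in> ?B" for A
    unfolding CR_def using closed_range_iff_gap_nat[OF that] by auto
  have "borel_in ?X CR"
    unfolding CR_def by (intro borel_in_fsigma fsigma_in_UN closed_imp_fsigma_in closedin_gap_ops) simp
  define Z where "Z = (\<Inter>i. nullity_ge i \<inter> defect_ge i :: ('a \<Rightarrow>\<^sub>L 'a) set)"
  have "borel_in ?X Z"
    unfolding Z_def by (intro borel_in_INT borel_in_fsigma fsigma_in_Int fN fD)
  have "borel_in ?X (\<Inter>i. rank_ge i)"
    by (intro borel_in_INT borel_in_open openin_rank_ge)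
  \<comment> \<open>For a closed range the closure is the range itself, so its infinite dimension is
    a condition on the rank.\<close>
  moreover have "Sigma1 \<infinity> \<infinity> = Z \<inter> CR \<inter> (\<Inter>i. rank_ge i)"
    unfolding Sigma1_def Z_def nullity_ge_def defect_ge_def rank_ge_def
    by (auto simp: enat_eq_infinity_iff CR)
  ultimately show "borel_in ?X (Sigma1 \<infinity> \<infinity>)"
    using \<open>borel_in ?X Z\<close> \<open>borel_in ?X CR\<close> by (simp add: borel_in_Int)
  have "Sigma0 \<infinity> \<infinity> = Z - CR"
    unfolding Sigma0_eq Z_def nullity_ge_def defect_ge_def
    by (auto simp: enat_eq_infinity_iff CR)
  then show "borel_in ?X (Sigma0 \<infinity> \<infinity>)"
    using \<open>borel_in ?X Z\<close> \<open>borel_in ?X CR\<close> by (simp add: borel_in_Diff)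
qed

end
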